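(* Let $\mathcal N_{XY}$ be the qubit channel $\mathcal N_{XY}(\rho)=\tfrac12(X\rho X+Y\rho Y)$, where $X,Y$ are the Pauli matrices. It is entanglement-breaking. For every $n\ge 2$, perfect random-receiver quantum communication of a qubit to $n$ receivers is possible using the channels $\mathcal A=\mathcal B=\mathcal N_{XY}^{\otimes n}$ in a quantum-controlled superposition of orders, assisted by one bit of classical information obtained by a binary measurement on the order qubit and sent to the chosen receiver. Precisely, let $\omega=|+\rangle\langle+|$ with $|+\rangle=(|0\rangle+|1\rangle)/\sqrt2$, and let $\mathcal S_\omega(\mathcal A,\mathcal B)$ be the switched channel. There exist an encoding channel $\mathcal E:L(\mathbb C^2)\to L((\mathbb C^2)^{\otimes n})$, a two-outcome POVM $(P_s)_{s\in\{+,-\}}$ on the order qubit, and, for every $x\in\{1,\dots,n\}$, a protocol of local operations and classical communication (LOCC) among the $n$ receivers, in which the classical value $s$ is supplied to receiver $B_x$, realizing channels $\Lambda^{(x)}_s:L((\mathbb C^2)^{\otimes n})\to L(\mathbb C^2)$ whose output qubit is held by $B_x$, such that for every $x\in\{1,\dots,n\}$ and every density operator $\rho$ on $\mathbb C^2$, $$\sum_{s\in\{+,-\}}\Lambda^{(x)}_s\Big(\operatorname{Tr}_{O}\big[(I^{\otimes n}\otimes P_s)\,\mathcal S_\omega(\mathcal A,\mathcal B)(\mathcal E(\rho))\big]\Big)=\rho,$$ where $\operatorname{Tr}_O$ is the partial trace over the order qubit. The encoding $\mathcal E$ and the measurement $(P_s)$ do not depend on $x$.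
   Context: $L(\mathcal H)$ denotes the linear operators on $\mathcal H$. A quantum channel is a completely positive trace-preserving linear map. A channel $\mathcal C$ is entanglement-breaking if it has the measure-and-prepare form $\mathcal C(\rho)=\sum_j\operatorname{Tr}[M_j\rho]\,\rho_j$ for some POVM $(M_j)$ and density operators $\rho_j$. Quantum SWITCH: for channels $\mathcal A,\mathcal B$ on the same system with Kraus operators $\{A_j\}$, $\{B_k\}$, the channel $\mathcal S(\mathcal A,\mathcal B)$ acts on the system together with a control qubit (the order qubit) and has Kraus operators $$S_{jk}=A_jB_k\otimes|0\rangle\langle0|+B_kA_j\otimes|1\rangle\langle1| ;$$ it does not depend on the chosen Kraus representations. For a state $\omega$ of the order qubit, the switched channel is $\mathcal S_\omega(\mathcal A,\mathcal B)(\rho):=\mathcal S(\mathcal A,\mathcal B)(\rho\otimes\omega)$. Random-receiver quantum communication: a sender transmits a quantum message to one receiver $B_x$ among $n$ spatially separated receivers $B_1,\dots,B_n$. The index $x$ is unknown to the sender but known to the receivers, who may exchange only classical messages. Here $\mathcal N_{XY}^{\otimes n}$ acts on $n$ qubits, the $i$-th of which is delivered to $B_i$. LOCC is with respect to the $n$ receivers, each holding one qubit. *)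

theory Defs
  imports "Jordan_Normal_Form.Schur_Decomposition"
begin

section \<open>Operators, states and measurements\<close>

text \<open>
  L(\<open>\<complex>\<^sup>d\<close>) is \<^term>\<open>carrier_mat d d :: complex mat set\<close>. Sums of matrices are taken entrywise and
  carry their dimensions explicitly, because \<^typ>\<open>complex mat\<close> has no zero common to all dimensions.
\<close>

definition msum :: "nat \<Rightarrow> 'i set \<Rightarrow> ('i \<Rightarrow> complex mat) \<Rightarrow> complex mat" where
  "msum d I M = mat d d (\<lambda>(a, b). \<Sum>j\<in>I. M j $$ (a, b))"

definition tr :: "complex mat \<Rightarrow> complex" where
  "tr A = (\<Sum>i<dim_row A. A $$ (i, i))"

definition psd :: "nat \<Rightarrow> complex mat \<Rightarrow> bool" where
  "psd d A \<longleftrightarrow> A \<in> carrier_mat d d \<and> (\<forall>v \<in> carrier_vec d. 0 \<le> (A *\<^sub>v v) \<bullet>c v)"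

definition density :: "nat \<Rightarrow> complex mat \<Rightarrow> bool" where
  "density d \<rho> \<longleftrightarrow> psd d \<rho> \<and> tr \<rho> = 1"

definition povm :: "nat \<Rightarrow> 'i set \<Rightarrow> ('i \<Rightarrow> complex mat) \<Rightarrow> bool" where
  "povm d I M \<longleftrightarrow> finite I \<and> (\<forall>j\<in>I. psd d (M j)) \<and> msum d I M = 1\<^sub>m d"

definition ketbra :: "complex vec \<Rightarrow> complex vec \<Rightarrow> complex mat" where
  "ketbra v w = mat (dim_vec v) (dim_vec w) (\<lambda>(i, j). v $ i * cnj (w $ j))"

text \<open>Kronecker product; the left factor is the most significant one.\<close>

definition tensor_mat :: "complex mat \<Rightarrow> complex mat \<Rightarrow> complex mat" (infixr \<open>\<otimes>\<^sub>m\<close> 75) where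
  "A \<otimes>\<^sub>m B = mat (dim_row A * dim_row B) (dim_col A * dim_col B)
     (\<lambda>(i, j). A $$ (i div dim_row B, j div dim_col B) * B $$ (i mod dim_row B, j mod dim_col B))"

text \<open>Partial trace over the second factor of \<open>\<complex>\<^sup>d \<otimes> \<complex>\<^sup>k\<close>.\<close>

definition ptrace2 :: "nat \<Rightarrow> nat \<Rightarrow> complex mat \<Rightarrow> complex mat" where
  "ptrace2 d k X = mat d d (\<lambda>(i, j). \<Sum>c<k. X $$ (i * k + c, j * k + c))"


section \<open>Quantum channels\<close>

type_synonym supop = "complex mat \<Rightarrow> complex mat"

definition linear_supop :: "nat \<Rightarrow> nat \<Rightarrow> supop \<Rightarrow> bool" where
  "linear_supop d e \<Phi> \<longleftrightarrow>
     (\<forall>A \<in> carrier_mat d d. \<Phi> A \<in> carrier_mat e e) \<and>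
     (\<forall>A \<in> carrier_mat d d. \<forall>B \<in> carrier_mat d d. \<Phi> (A + B) = \<Phi> A + \<Phi> B) \<and>
     (\<forall>A \<in> carrier_mat d d. \<forall>c. \<Phi> (c \<cdot>\<^sub>m A) = c \<cdot>\<^sub>m \<Phi> A)"

definition mat_unit :: "nat \<Rightarrow> nat \<Rightarrow> nat \<Rightarrow> complex mat" where
  "mat_unit d i j = ketbra (unit_vec d i) (unit_vec d j)"

text \<open>
  The tensor product of linear maps \<open>\<Phi>\<close> and \<open>\<Psi>\<close>: the linear map sending
  \<open>E\<^sub>i\<^sub>j \<otimes> E\<^sub>k\<^sub>l\<close> to \<open>\<Phi>(E\<^sub>i\<^sub>j) \<otimes> \<Psi>(E\<^sub>k\<^sub>l)\<close> for all matrix units.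
\<close>

definition tensor_supop :: "nat \<Rightarrow> nat \<Rightarrow> supop \<Rightarrow> nat \<Rightarrow> nat \<Rightarrow> supop \<Rightarrow> supop" where
  "tensor_supop d e \<Phi> d' e' \<Psi> X = mat (e * e') (e * e') (\<lambda>(a, b).
     \<Sum>i<d. \<Sum>j<d. \<Sum>k<d'. \<Sum>l<d'.
       X $$ (i * d' + k, j * d' + l) * (\<Phi> (mat_unit d i j) \<otimes>\<^sub>m \<Psi> (mat_unit d' k l)) $$ (a, b))"

definition completely_positive :: "nat \<Rightarrow> nat \<Rightarrow> supop \<Rightarrow> bool" where
  "completely_positive d e \<Phi> \<longleftrightarrow>
     (\<forall>k. \<forall>X. psd (d * k) X \<longrightarrow> psd (e * k) (tensor_supop d e \<Phi> k k id X))"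

definition cp_map :: "nat \<Rightarrow> nat \<Rightarrow> supop \<Rightarrow> bool" where
  "cp_map d e \<Phi> \<longleftrightarrow> linear_supop d e \<Phi> \<and> completely_positive d e \<Phi>"

definition quantum_channel :: "nat \<Rightarrow> nat \<Rightarrow> supop \<Rightarrow> bool" where
  "quantum_channel d e \<Phi> \<longleftrightarrow> cp_map d e \<Phi> \<and> (\<forall>A \<in> carrier_mat d d. tr (\<Phi> A) = tr A)"

definition entanglement_breaking :: "nat \<Rightarrow> nat \<Rightarrow> supop \<Rightarrow> bool" where
  "entanglement_breaking d e \<C> \<longleftrightarrow> quantum_channel d e \<C> \<and>
     (\<exists>(m :: nat) M \<sigma>. povm d {..<m} M \<and> (\<forall>j<m. density e (\<sigma> j)) \<and>
        (\<forall>\<rho> \<in> carrier_mat d d. \<C> \<rho> = msum e {..<m} (\<lambda>j. tr (M j * \<rho>) \<cdot>\<^sub>m \<sigma> j)))"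

text \<open>\<open>\<Phi>\<^sup>\<otimes>\<^sup>n\<close> for \<open>\<Phi> : L(\<complex>\<^sup>d) \<rightarrow> L(\<complex>\<^sup>d)\<close>.\<close>

primrec supop_power :: "nat \<Rightarrow> supop \<Rightarrow> nat \<Rightarrow> supop" where
  "supop_power d \<Phi> 0 = id"
| "supop_power d \<Phi> (Suc n) = tensor_supop d d \<Phi> (d ^ n) (d ^ n) (supop_power d \<Phi> n)"


section \<open>The quantum switch\<close>

definition kraus_map :: "nat \<Rightarrow> complex mat list \<Rightarrow> supop" where
  "kraus_map e Ks \<rho> = mat e e (\<lambda>(a, b). \<Sum>K\<leftarrow>Ks. (K * \<rho> * mat_adjoint K) $$ (a, b))"

definition kraus_rep :: "nat \<Rightarrow> nat \<Rightarrow> supop \<Rightarrow> complex mat list \<Rightarrow> bool" where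
  "kraus_rep d e \<Phi> Ks \<longleftrightarrow>
     set Ks \<subseteq> carrier_mat e d \<and> (\<forall>\<rho> \<in> carrier_mat d d. \<Phi> \<rho> = kraus_map e Ks \<rho>)"

definition ket0 :: "complex vec" where "ket0 = unit_vec 2 0"
definition ket1 :: "complex vec" where "ket1 = unit_vec 2 1"

definition ket_plus :: "complex vec" where
  "ket_plus = complex_of_real (1 / sqrt 2) \<cdot>\<^sub>v (ket0 + ket1)"

definition switch_kraus :: "complex mat list \<Rightarrow> complex mat list \<Rightarrow> complex mat list" where
  "switch_kraus As Bs =
     [(A * B) \<otimes>\<^sub>m ketbra ket0 ket0 + (B * A) \<otimes>\<^sub>m ketbra ket1 ket1. A \<leftarrow> As, B \<leftarrow> Bs]"

text \<open>
  The result does not depend on which Kraus representations are selected. The order qubit is the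
  right tensor factor.
\<close>

definition quantum_switch :: "nat \<Rightarrow> supop \<Rightarrow> supop \<Rightarrow> supop" where
  "quantum_switch d \<A> \<B> = kraus_map (d * 2)
     (switch_kraus (SOME As. kraus_rep d d \<A> As) (SOME Bs. kraus_rep d d \<B> Bs))"

definition switched_channel :: "nat \<Rightarrow> complex mat \<Rightarrow> supop \<Rightarrow> supop \<Rightarrow> supop" where
  "switched_channel d \<omega> \<A> \<B> \<rho> = quantum_switch d \<A> \<B> (\<rho> \<otimes>\<^sub>m \<omega>)"


section \<open>LOCC with a classical input at one receiver\<close>

text \<open>A quantum instrument with outcomes \<open>k < m\<close> and outcome-dependent output dimension \<open>e k\<close>.\<close>

definition instrument :: "nat \<Rightarrow> nat \<Rightarrow> (nat \<Rightarrow> nat) \<Rightarrow> (nat \<Rightarrow> supop) \<Rightarrow> bool" where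
  "instrument d m e J \<longleftrightarrow>
     (\<forall>k<m. 0 < e k \<and> cp_map d (e k) (J k)) \<and>
     (\<forall>A \<in> carrier_mat d d. (\<Sum>k<m. tr (J k A)) = tr A)"

text \<open>
  Party \<open>i\<close> applies \<open>J\<close>, with output dimension \<open>e\<close>, to its own system; \<open>ds\<close> lists the local
  dimensions of all parties, in the order of the tensor factors.
\<close>

definition local_supop :: "nat list \<Rightarrow> nat \<Rightarrow> nat \<Rightarrow> supop \<Rightarrow> supop" where
  "local_supop ds i e J =
     (let l = prod_list (take i ds); r = prod_list (drop (Suc i) ds)
      in tensor_supop l l id (ds ! i * r) (e * r) (tensor_supop (ds ! i) e J r r id))"

text \<open>
  \<open>locc x ds es \<Lambda>\<close>: a finite-round LOCC protocol in which a classical value \<open>s\<close> is given to party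
  \<open>x\<close> alone realizes the maps \<open>\<Lambda> s\<close> from local dimensions \<open>ds\<close> to local dimensions \<open>es\<close>.
  In each round one party performs an instrument on its own system and broadcasts the outcome \<open>k\<close>;
  the rest of the protocol may depend on \<open>k\<close>. Only the instruments of party \<open>x\<close> may depend on \<open>s\<close>;
  everyone else can learn about \<open>s\<close> only through the broadcast outcomes.
  Since the local dimension may change, local ancillas and the discarding of local systems
  (passing to dimension 1) are included.
\<close>

inductive locc :: "nat \<Rightarrow> nat list \<Rightarrow> nat list \<Rightarrow> ('s \<Rightarrow> supop) \<Rightarrow> bool" for x where
  locc_done: "locc x es es (\<lambda>s. id)"
| locc_round:
    "\<lbrakk> i < length ds;
       \<forall>s. instrument (ds ! i) m e (J s);
       i \<noteq> x \<longrightarrow> (\<forall>s s'. J s = J s');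
       \<forall>k<m. locc x (ds[i := e k]) es (\<Lambda> k) \<rbrakk>
     \<Longrightarrow> locc x ds es
           (\<lambda>s R. msum (prod_list es) {..<m} (\<lambda>k. \<Lambda> k s (local_supop ds i (e k) (J s k) R)))"


section \<open>The channel\<close>

definition pauli_X :: "complex mat" where
  "pauli_X = mat_of_rows_list 2 [[0, 1], [1, 0]]"

definition pauli_Y :: "complex mat" where
  "pauli_Y = mat_of_rows_list 2 [[0, - \<i>], [\<i>, 0]]"

definition N_XY :: supop where
  "N_XY \<rho> = (1/2) \<cdot>\<^sub>m (pauli_X * \<rho> * pauli_X + pauli_Y * \<rho> * pauli_Y)"

datatype order_outcome = Out_plus | Out_minus

end

theory Submission
  imports Defs
begin

text \<open>
  In terms of matrix entries \<open>N_XY\<close> keeps only the diagonal and reverses it, and hence so does its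
  \<open>n\<close>-fold tensor power. The blocks of the switched state that are diagonal in the order qubit
  are therefore the diagonal of the input (two reversals), while the off-diagonal blocks are its
  antidiagonal. Measuring the order qubit in the basis \<open>|\<plusminus>\<rangle>\<close> leaves half of diagonal \<open>\<plusminus>\<close> antidiagonal.
  A state encoded as \<open>|0\<rangle> \<mapsto> |0\<dots>0\<rangle>, |1\<rangle> \<mapsto> |1\<dots>1\<rangle>\<close> lives at the four corners of the matrix, that is, on
  the diagonal and antidiagonal, so it survives up to a logical phase flip when the outcome is \<open>-\<close>.
  The receivers other than \<open>x\<close> measure in the basis \<open>|\<plusminus>\<rangle>\<close>, each of which removes one qubit from the
  code at the price of another known phase flip, and \<open>x\<close> undoes the total phase.
\<close>

section \<open>Sums and matrix entries\<close>

text \<open>An index of a tensor product is a pair of digits \<open>i * k + c\<close>; this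
  separates a sum over it into one sum per factor.\<close>

lemma sum_mult_split:
  fixes f :: "nat \<Rightarrow> 'a::comm_monoid_add"
  shows "(\<Sum>a<e * k. f a) = (\<Sum>i<e. \<Sum>c<k. f (i * k + c))"
proof -
  have "(\<Sum>a<e * k. f a) = (\<Sum>i<e. sum f {i * k..<i * k + k})"
    by (simp add: sum.nat_group)
  also have "\<dots> = (\<Sum>i<e. \<Sum>c<k. f (i * k + c))"
  proof (rule sum.cong[OF refl])
    fix i
    show "sum f {i * k..<i * k + k} = (\<Sum>c<k. f (i * k + c))"
      using sum.shift_bounds_nat_ivl[of f 0 "i * k" k] by (simp add: atLeast0LessThan add.commute)
  qed
  finally show ?thesis .
qed

lemma index_lt_mult:
  fixes i k e c :: nat
  assumes "i < e" "c < k"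
  shows "i * k + c < e * k"
proof -
  have "i * k + c < Suc i * k" using assms by simp
  also have "\<dots> \<le> e * k" using assms by (intro mult_le_mono1) simp
  finally show ?thesis .
qed

lemma div_mod_mult_less:
  fixes a e k :: nat
  assumes "a < e * k"
  shows "a div k < e" "a mod k < k"
  using assms by (auto simp: less_mult_imp_div_less) (metis mod_less_divisor mult_0_right not_gr_zero not_less0)

text \<open>Entries of matrix units are joint Kronecker deltas of this kind, and their equations are
  met in both orientations.\<close>

lemma sum_delta2:
  fixes f :: "nat \<Rightarrow> nat \<Rightarrow> 'a::semiring_1"
  assumes "x < k" "y < l"
  shows "(\<Sum>i<k. \<Sum>j<l. f i j * of_bool (i = x \<and> j = y)) = f x y"
    and "(\<Sum>i<k. \<Sum>j<l. f i j * of_bool (x = i \<and> y = j)) = f x y"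
proof -
  have "(\<Sum>i<k. \<Sum>j<l. f i j * of_bool (i = x \<and> j = y)) = (\<Sum>i<k. if i = x then f x y else 0)"
  proof (intro sum.cong refl)
    fix i
    have "(\<Sum>j<l. f i j * of_bool (i = x \<and> j = y)) = (\<Sum>j<l. if j = y then (if i = x then f x y else 0) else 0)"
      by (intro sum.cong refl) auto
    then show "(\<Sum>j<l. f i j * of_bool (i = x \<and> j = y)) = (if i = x then f x y else 0)"
      using assms by simp
  qed
  then show *: "(\<Sum>i<k. \<Sum>j<l. f i j * of_bool (i = x \<and> j = y)) = f x y" using assms by simp
  then show "(\<Sum>i<k. \<Sum>j<l. f i j * of_bool (x = i \<and> y = j)) = f x y"
    by (simp only: eq_commute[of x] eq_commute[of y])
qed

section \<open>Matrix units, Kronecker products and tensor products of maps in coordinates\<close>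

lemma mat_unit_carrier [simp]: "mat_unit d i j \<in> carrier_mat d d"
  by (intro carrier_matI) (simp_all add: mat_unit_def ketbra_def)

lemma mat_unit_index:
  assumes "a < d" "b < d" "i < d" "j < d"
  shows "mat_unit d i j $$ (a, b) = of_bool (i = a \<and> j = b)"
  using assms by (simp add: mat_unit_def ketbra_def unit_vec_def)

lemma tensor_mat_index:
  assumes "A \<in> carrier_mat p q" "B \<in> carrier_mat r s" "a < p * r" "b < q * s"
  shows "(A \<otimes>\<^sub>m B) $$ (a, b) = A $$ (a div r, b div s) * B $$ (a mod r, b mod s)"
  using assms by (simp add: tensor_mat_def)

lemma tensor_mat_carrier:
  assumes "A \<in> carrier_mat p q" "B \<in> carrier_mat r s"
  shows "A \<otimes>\<^sub>m B \<in> carrier_mat (p * r) (q * s)"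
  using assms by (intro carrier_matI) (simp_all add: tensor_mat_def)

lemma tensor_supop_index:
  assumes \<Phi>: "\<And>i j. i < d \<Longrightarrow> j < d \<Longrightarrow> \<Phi> (mat_unit d i j) \<in> carrier_mat e e"
    and \<Psi>: "\<And>i j. i < d' \<Longrightarrow> j < d' \<Longrightarrow> \<Psi> (mat_unit d' i j) \<in> carrier_mat e' e'"
    and ab: "a < e * e'" "b < e * e'"
  shows "tensor_supop d e \<Phi> d' e' \<Psi> X $$ (a, b) =
    (\<Sum>i<d. \<Sum>j<d. \<Sum>k<d'. \<Sum>l<d'. X $$ (i * d' + k, j * d' + l) *
      (\<Phi> (mat_unit d i j) $$ (a div e', b div e') * \<Psi> (mat_unit d' k l) $$ (a mod e', b mod e')))"
proof -
  have "(\<Phi> (mat_unit d i j) \<otimes>\<^sub>m \<Psi> (mat_unit d' k l)) $$ (a, b) =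
      \<Phi> (mat_unit d i j) $$ (a div e', b div e') * \<Psi> (mat_unit d' k l) $$ (a mod e', b mod e')"
    if "i < d" "j < d" "k < d'" "l < d'" for i j k l
    using tensor_mat_index[OF \<Phi>[OF that(1,2)] \<Psi>[OF that(3,4)] ab] .
  then show ?thesis using ab by (simp add: tensor_supop_def)
qed

lemma tensor_supop_carrier [simp]: "tensor_supop d e \<Phi> d' e' \<Psi> X \<in> carrier_mat (e * e') (e * e')"
  unfolding tensor_supop_def by (rule mat_carrier)

lemma tensor_supop_dim [simp]:
  "dim_row (tensor_supop d e \<Phi> d' e' \<Psi> X) = e * e'" "dim_col (tensor_supop d e \<Phi> d' e' \<Psi> X) = e * e'"
  by (simp_all add: tensor_supop_def)

text \<open>On the factor left alone, the matrix unit is a delta that fixes both inner indices at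
  the digits \<open>a mod k\<close> and \<open>b mod k\<close>; only the sum over the other factor
  remains.\<close>

lemma tensor_supop_id_right_index:
  assumes \<Phi>: "\<And>i j. i < d \<Longrightarrow> j < d \<Longrightarrow> \<Phi> (mat_unit d i j) \<in> carrier_mat e e"
    and ab: "a < e * k" "b < e * k"
  shows "tensor_supop d e \<Phi> k k id X $$ (a, b) =
    (\<Sum>i<d. \<Sum>j<d. X $$ (i * k + a mod k, j * k + b mod k) * \<Phi> (mat_unit d i j) $$ (a div k, b div k))"
proof -
  note m = div_mod_mult_less[OF ab(1)] div_mod_mult_less[OF ab(2)]
  have "(\<Sum>p<k. \<Sum>q<k. X $$ (i * k + p, j * k + q) *
      (\<Phi> (mat_unit d i j) $$ (a div k, b div k) * id (mat_unit k p q) $$ (a mod k, b mod k))) =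
     X $$ (i * k + a mod k, j * k + b mod k) * \<Phi> (mat_unit d i j) $$ (a div k, b div k)" for i j
    using sum_delta2(1)[OF m(2,4), of "\<lambda>p q. X $$ (i * k + p, j * k + q) *
       \<Phi> (mat_unit d i j) $$ (a div k, b div k)"] m
    by (simp add: mat_unit_index mult.assoc del: sum_mult_of_bool_eq sum_of_bool_mult_eq)
  then show ?thesis
    by (subst tensor_supop_index[where \<Phi> = \<Phi>, OF \<Phi> _ ab]) simp_all
qed

lemma tensor_supop_id_left_index:
  assumes \<Psi>: "\<And>i j. i < d \<Longrightarrow> j < d \<Longrightarrow> \<Psi> (mat_unit d i j) \<in> carrier_mat e e"
    and ab: "a < k * e" "b < k * e"
  shows "tensor_supop k k id d e \<Psi> X $$ (a, b) =
    (\<Sum>i<d. \<Sum>j<d. X $$ ((a div e) * d + i, (b div e) * d + j) * \<Psi> (mat_unit d i j) $$ (a mod e, b mod e))"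
proof -
  note m = div_mod_mult_less[OF ab(1)] div_mod_mult_less[OF ab(2)]
  have "tensor_supop k k id d e \<Psi> X $$ (a, b) =
    (\<Sum>p<k. \<Sum>q<k. (\<Sum>i<d. \<Sum>j<d. X $$ (p * d + i, q * d + j) *
        \<Psi> (mat_unit d i j) $$ (a mod e, b mod e)) * of_bool (p = a div e \<and> q = b div e))"
    using m by (subst tensor_supop_index[where \<Psi> = \<Psi>, OF _ \<Psi> ab])
      (simp_all add: mat_unit_index sum_distrib_right sum_distrib_left mult_ac del: sum_mult_of_bool_eq sum_of_bool_mult_eq)
  also note sum_delta2(1)[OF m(1,3)]
  finally show ?thesis .
qed

section \<open>Kraus maps and positive semidefinite matrices in coordinates\<close>

lemma kraus_map_dim [simp]:
  "dim_row (kraus_map e Ks X) = e" "dim_col (kraus_map e Ks X) = e"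
  by (simp_all add: kraus_map_def)

lemma kraus_map_carrier [simp]: "kraus_map e Ks X \<in> carrier_mat e e"
  by (intro carrier_matI) simp_all

lemma mat_adjoint_index:
  assumes "A \<in> carrier_mat p q" "i < q" "j < p"
  shows "mat_adjoint A $$ (i, j) = cnj (A $$ (j, i))"
  using assms by (simp add: mat_adjoint_def mat_of_rows_def)

lemma mat_adjoint_carrier:
  assumes "A \<in> carrier_mat p q"
  shows "mat_adjoint A \<in> carrier_mat q p"
  using assms by (intro carrier_matI) (simp_all add: mat_adjoint_def)

lemma mat_mult_index:
  assumes "A \<in> carrier_mat p q" "B \<in> carrier_mat q r" "i < p" "j < r"
  shows "(A * B) $$ (i, j) = (\<Sum>k<q. A $$ (i, k) * B $$ (k, j))"
  using assms by (simp add: scalar_prod_def atLeast0LessThan)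

lemma kraus_map_index:
  assumes "set Ks \<subseteq> carrier_mat e d" "X \<in> carrier_mat d d" "a < e" "b < e"
  shows "kraus_map e Ks X $$ (a, b) =
    (\<Sum>K\<leftarrow>Ks. \<Sum>p<d. \<Sum>q<d. K $$ (a, p) * X $$ (p, q) * cnj (K $$ (b, q)))"
proof -
  have "(K * X * mat_adjoint K) $$ (a, b) =
      (\<Sum>p<d. \<Sum>q<d. K $$ (a, p) * X $$ (p, q) * cnj (K $$ (b, q)))" if "K \<in> set Ks" for K
  proof -
    have K: "K \<in> carrier_mat e d" using that assms by auto
    have "(K * X * mat_adjoint K) $$ (a, b) = (\<Sum>q<d. (K * X) $$ (a, q) * mat_adjoint K $$ (q, b))"
      using K assms by (intro mat_mult_index) (auto simp: mat_adjoint_carrier)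
    also have "\<dots> = (\<Sum>q<d. (\<Sum>p<d. K $$ (a, p) * X $$ (p, q)) * cnj (K $$ (b, q)))"
      using K assms by (intro sum.cong refl)
        (simp only: mat_mult_index[OF K assms(2)] mat_adjoint_index[OF K] lessThan_iff)
    also have "\<dots> = (\<Sum>p<d. \<Sum>q<d. K $$ (a, p) * X $$ (p, q) * cnj (K $$ (b, q)))"
      by (subst sum.swap) (simp add: sum_distrib_right)
    finally show ?thesis .
  qed
  then show ?thesis using assms(3,4)
    by (simp add: kraus_map_def cong: map_cong)
qed

lemma kraus_map_mat_unit_index:
  assumes "set Ks \<subseteq> carrier_mat e d" "i < d" "j < d" "a < e" "b < e"
  shows "kraus_map e Ks (mat_unit d i j) $$ (a, b) = (\<Sum>K\<leftarrow>Ks. K $$ (a, i) * cnj (K $$ (b, j)))"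
proof -
  have "(\<Sum>p<d. \<Sum>q<d. K $$ (a, p) * mat_unit d i j $$ (p, q) * cnj (K $$ (b, q))) =
      K $$ (a, i) * cnj (K $$ (b, j))" for K :: "complex mat"
    using sum_delta2(2)[OF assms(2,3), of "\<lambda>p q. K $$ (a, p) * cnj (K $$ (b, q))"] assms
    by (simp add: mat_unit_index mult_ac del: sum_mult_of_bool_eq sum_of_bool_mult_eq)
  then show ?thesis using assms
    by (subst kraus_map_index[of _ _ d]) simp_all
qed

text \<open>Only values below \<open>d\<close> enter the sums, so the test vector may be an
  arbitrary function. This frees later rearrangements from dimension conditions.\<close>

lemma psd_iff:
  "psd d A \<longleftrightarrow> A \<in> carrier_mat d d \<and>
     (\<forall>v. 0 \<le> (\<Sum>a<d. \<Sum>b<d. A $$ (a, b) * v b * cnj (v a)))"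
proof (cases "A \<in> carrier_mat d d")
  case True
  have *: "(A *\<^sub>v v) \<bullet>c v = (\<Sum>a<d. \<Sum>b<d. A $$ (a, b) * v $ b * cnj (v $ a))"
    if "v \<in> carrier_vec d" for v
    using that True by (simp add: scalar_prod_def atLeast0LessThan sum_distrib_right)
  have vec: "(A *\<^sub>v vec d v) \<bullet>c vec d v = (\<Sum>a<d. \<Sum>b<d. A $$ (a, b) * v b * cnj (v a))" for v
    by (subst *) simp_all
  show ?thesis
  proof (intro iffI conjI allI)
    fix v
    assume "psd d A"
    then have "0 \<le> (A *\<^sub>v vec d v) \<bullet>c vec d v"
      unfolding psd_def using vec_carrier by blast
    then show "0 \<le> (\<Sum>a<d. \<Sum>b<d. A $$ (a, b) * v b * cnj (v a))"
      by (simp only: vec)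
  next
    assume "A \<in> carrier_mat d d \<and> (\<forall>v. 0 \<le> (\<Sum>a<d. \<Sum>b<d. A $$ (a, b) * v b * cnj (v a)))"
    then have nonneg: "0 \<le> (\<Sum>a<d. \<Sum>b<d. A $$ (a, b) * v b * cnj (v a))" for v
      by blast
    show "psd d A" unfolding psd_def
    proof (intro conjI ballI True)
      fix v :: "complex vec" assume "v \<in> carrier_vec d"
      from nonneg[of "\<lambda>b. v $ b"] show "0 \<le> (A *\<^sub>v v) \<bullet>c v"
        unfolding *[OF \<open>v \<in> carrier_vec d\<close>] .
    qed
  qed (rule True)
qed (simp add: psd_def)

lemma complex_mult_cnj_nonneg: "0 \<le> z * cnj (z :: complex)"
  by (simp add: complex_mult_cnj less_eq_complex_def)

text \<open>The quadratic form factors as z times its conjugate, where z is the overlap of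
  \<open>v\<close> with the test vector.\<close>

lemma psd_ketbra:
  assumes "v \<in> carrier_vec d"
  shows "psd d (ketbra v v)"
proof -
  have "(\<Sum>a<d. \<Sum>b<d. ketbra v v $$ (a, b) * w b * cnj (w a)) =
      (\<Sum>a<d. v $ a * cnj (w a)) * cnj (\<Sum>b<d. v $ b * cnj (w b))" for w
    using assms unfolding cnj_sum sum_product
    by (intro sum.cong refl) (simp add: ketbra_def mult_ac)
  moreover have "ketbra v v \<in> carrier_mat d d"
    using assms by (intro carrier_matI) (simp_all add: ketbra_def)
  ultimately show ?thesis
    by (simp only: psd_iff complex_mult_cnj_nonneg simp_thms)
qed

lemma sum_swap_pairs:
  "(\<Sum>a\<in>A. \<Sum>b\<in>B. \<Sum>p\<in>C. \<Sum>q\<in>D. f a b p q) = (\<Sum>p\<in>C. \<Sum>q\<in>D. \<Sum>a\<in>A. \<Sum>b\<in>B. f a b p q)"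
proof -
  have "(\<Sum>a\<in>A. \<Sum>b\<in>B. \<Sum>p\<in>C. \<Sum>q\<in>D. f a b p q) = (\<Sum>a\<in>A. \<Sum>p\<in>C. \<Sum>q\<in>D. \<Sum>b\<in>B. f a b p q)"
    by (intro sum.cong refl) (subst sum.swap, intro sum.cong refl sum.swap)
  also have "\<dots> = (\<Sum>p\<in>C. \<Sum>q\<in>D. \<Sum>a\<in>A. \<Sum>b\<in>B. f a b p q)"
    by (subst sum.swap, intro sum.cong refl sum.swap)
  finally show ?thesis .
qed

lemma sum_sum_list_swap:
  "(\<Sum>a\<in>A. \<Sum>K\<leftarrow>Ks. f a K) = (\<Sum>K\<leftarrow>Ks. \<Sum>a\<in>A. f a K)"
  by (induction Ks) (simp_all add: sum.distrib)

section \<open>Complete positivity of Kraus maps\<close>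

lemma sum_list_nonneg_complex:
  assumes "\<And>K. K \<in> set Ks \<Longrightarrow> 0 \<le> (f K :: complex)"
  shows "0 \<le> (\<Sum>K\<leftarrow>Ks. f K)"
  using assms by (induction Ks) (auto simp: less_eq_complex_def)

lemma psd_carrier: "psd d A \<Longrightarrow> A \<in> carrier_mat d d"
  by (simp add: psd_def)

text \<open>Moving K to the other side of the inner product shows that each Kraus operator
  contributes a value of the quadratic form of \<open>X\<close>.\<close>

lemma psd_kraus_map:
  assumes Ks: "set Ks \<subseteq> carrier_mat e d" and X: "psd d X"
  shows "psd e (kraus_map e Ks X)"
proof -
  have Xc: "X \<in> carrier_mat d d" using X by (rule psd_carrier)
  have "0 \<le> (\<Sum>a<e. \<Sum>b<e. kraus_map e Ks X $$ (a, b) * v b * cnj (v a))" for v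
  proof -
    \<comment> \<open>\<open>?w K\<close> is the adjoint of K applied to \<open>v\<close>, the
      vector at which the form of \<open>X\<close> is evaluated.\<close>
    let ?w = "\<lambda>K q. \<Sum>b<e. cnj (K $$ (b, q)) * v b"
    have "(\<Sum>a<e. \<Sum>b<e. kraus_map e Ks X $$ (a, b) * v b * cnj (v a)) =
      (\<Sum>a<e. \<Sum>b<e. \<Sum>K\<leftarrow>Ks. \<Sum>p<d. \<Sum>q<d. K $$ (a, p) * X $$ (p, q) * cnj (K $$ (b, q)) * (v b * cnj (v a)))"
      by (intro sum.cong refl)
        (simp add: kraus_map_index[OF Ks Xc] sum_list_mult_const[symmetric] sum_distrib_right mult.assoc)
    also have "\<dots> = (\<Sum>K\<leftarrow>Ks. \<Sum>a<e. \<Sum>b<e. \<Sum>p<d. \<Sum>q<d.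
        K $$ (a, p) * X $$ (p, q) * cnj (K $$ (b, q)) * (v b * cnj (v a)))"
      by (simp only: sum_sum_list_swap)
    also have "\<dots> = (\<Sum>K\<leftarrow>Ks. \<Sum>p<d. \<Sum>q<d. \<Sum>a<e. \<Sum>b<e.
        K $$ (a, p) * X $$ (p, q) * cnj (K $$ (b, q)) * (v b * cnj (v a)))"
      by (subst sum_swap_pairs) (rule refl)
    also have "\<dots> = (\<Sum>K\<leftarrow>Ks. \<Sum>p<d. \<Sum>q<d. X $$ (p, q) * ?w K q * cnj (?w K p))"
    proof -
      have "(\<Sum>a<e. \<Sum>b<e. K $$ (a, p) * X $$ (p, q) * cnj (K $$ (b, q)) * (v b * cnj (v a))) =
        X $$ (p, q) * ?w K q * cnj (?w K p)" for K p q
        by (subst sum.swap) (simp add: sum_product sum_distrib_left mult_ac)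
      then show ?thesis by (simp only:)
    qed
    also have "0 \<le> \<dots>"
      using X by (intro sum_list_nonneg_complex) (simp only: psd_iff)
    finally show ?thesis .
  qed
  then show ?thesis by (simp only: psd_iff kraus_map_carrier simp_thms)
qed

text \<open>A \<open>supop\<close> takes values on matrices of every size, but being a CP map
  concerns only those in L(C^d). This carries complete positivity from a Kraus form over to an
  entrywise formula.\<close>

lemma cp_map_cong:
  assumes "\<And>A. A \<in> carrier_mat d d \<Longrightarrow> \<Phi> A = \<Psi> A"
  shows "cp_map d e \<Phi> \<longleftrightarrow> cp_map d e \<Psi>"
proof -
  have "tensor_supop d e \<Phi> k k id X = tensor_supop d e \<Psi> k k id X" for k X
    unfolding tensor_supop_def using assms[OF mat_unit_carrier] by simp
  then show ?thesis
    using assms by (auto simp: cp_map_def completely_positive_def linear_supop_def)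
qed

lemma linear_supop_kraus_map:
  assumes Ks: "set Ks \<subseteq> carrier_mat e d"
  shows "linear_supop d e (kraus_map e Ks)"
proof -
  have "kraus_map e Ks (A + B) = kraus_map e Ks A + kraus_map e Ks B"
    if A: "A \<in> carrier_mat d d" and B: "B \<in> carrier_mat d d" for A B
  proof (rule eq_matI)
    fix a b assume "a < dim_row (kraus_map e Ks A + kraus_map e Ks B)"
      "b < dim_col (kraus_map e Ks A + kraus_map e Ks B)"
    then have ab: "a < e" "b < e" by simp_all
    show "kraus_map e Ks (A + B) $$ (a, b) = (kraus_map e Ks A + kraus_map e Ks B) $$ (a, b)"
      using A B ab
      by (simp add: kraus_map_index[OF Ks] distrib_left distrib_right sum.distrib sum_list_addf)
  qed simp_all
  moreover have "kraus_map e Ks (c \<cdot>\<^sub>m A) = c \<cdot>\<^sub>m kraus_map e Ks A"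
    if A: "A \<in> carrier_mat d d" for A c
  proof (rule eq_matI)
    fix a b assume "a < dim_row (c \<cdot>\<^sub>m kraus_map e Ks A)" "b < dim_col (c \<cdot>\<^sub>m kraus_map e Ks A)"
    then have ab: "a < e" "b < e" by simp_all
    show "kraus_map e Ks (c \<cdot>\<^sub>m A) $$ (a, b) = (c \<cdot>\<^sub>m kraus_map e Ks A) $$ (a, b)"
      using A ab
      by (simp add: kraus_map_index[OF Ks] sum_list_const_mult[symmetric] sum_distrib_left mult_ac)
  qed simp_all
  ultimately show ?thesis by (simp add: linear_supop_def)
qed

text \<open>The matrices in the new list are K tensored with the identity of dimension
  \<open>k\<close>, written entrywise.\<close>

lemma tensor_supop_kraus_map_id:
  assumes Ks: "set Ks \<subseteq> carrier_mat e d" and X: "X \<in> carrier_mat (d * k) (d * k)"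
  shows "tensor_supop d e (kraus_map e Ks) k k id X =
    kraus_map (e * k) (map (\<lambda>K. mat (e * k) (d * k)
      (\<lambda>(a, x). K $$ (a div k, x div k) * of_bool (a mod k = x mod k))) Ks) X"
    (is "_ = kraus_map _ (map ?L Ks) X")
proof (rule eq_matI)
  fix a b assume "a < dim_row (kraus_map (e * k) (map ?L Ks) X)"
    "b < dim_col (kraus_map (e * k) (map ?L Ks) X)"
  then have ab: "a < e * k" "b < e * k" by simp_all
  note m = div_mod_mult_less[OF ab(1)] div_mod_mult_less[OF ab(2)]
  have "(\<Sum>p<d * k. \<Sum>q<d * k. ?L K $$ (a, p) * X $$ (p, q) * cnj (?L K $$ (b, q))) =
    (\<Sum>i<d. \<Sum>j<d. X $$ (i * k + a mod k, j * k + b mod k) * (K $$ (a div k, i) * cnj (K $$ (b div k, j))))" for K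
  proof -
    have "(\<Sum>p<d * k. \<Sum>q<d * k. ?L K $$ (a, p) * X $$ (p, q) * cnj (?L K $$ (b, q))) =
      (\<Sum>i<d. \<Sum>c<k. \<Sum>j<d. \<Sum>c'<k. ?L K $$ (a, i * k + c) * X $$ (i * k + c, j * k + c') *
         cnj (?L K $$ (b, j * k + c')))"
      by (simp only: sum_mult_split)
    also have "\<dots> = (\<Sum>i<d. \<Sum>j<d. \<Sum>c<k. \<Sum>c'<k. ?L K $$ (a, i * k + c) * X $$ (i * k + c, j * k + c') *
         cnj (?L K $$ (b, j * k + c')))"
      by (intro sum.cong refl sum.swap)
    also have "\<dots> = (\<Sum>i<d. \<Sum>j<d. \<Sum>c<k. \<Sum>c'<k.
         (X $$ (i * k + c, j * k + c') * (K $$ (a div k, i) * cnj (K $$ (b div k, j)))) *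
          of_bool (a mod k = c \<and> b mod k = c'))"
      by (intro sum.cong refl) (auto simp: ab index_lt_mult)
    finally show ?thesis by (simp only: sum_delta2(2)[OF m(2,4)])
  qed
  moreover have "set (map ?L Ks) \<subseteq> carrier_mat (e * k) (d * k)" by auto
  ultimately have "kraus_map (e * k) (map ?L Ks) X $$ (a, b) =
    (\<Sum>K\<leftarrow>Ks. \<Sum>i<d. \<Sum>j<d. X $$ (i * k + a mod k, j * k + b mod k) * (K $$ (a div k, i) * cnj (K $$ (b div k, j))))"
    using kraus_map_index[of "map ?L Ks", OF _ X ab] by (simp only: list.map_comp o_def)
  also have "\<dots> = tensor_supop d e (kraus_map e Ks) k k id X $$ (a, b)"
    using m ab by (subst tensor_supop_id_right_index)
     (simp_all add: kraus_map_mat_unit_index[OF Ks] sum_sum_list_swap sum_list_const_mult[symmetric])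
  finally show "tensor_supop d e (kraus_map e Ks) k k id X $$ (a, b) =
    kraus_map (e * k) (map ?L Ks) X $$ (a, b)" by simp
qed simp_all

text \<open>Adjoining an ancilla turns a Kraus map into another Kraus map, and those preserve
  positivity.\<close>

lemma cp_map_kraus_map:
  assumes Ks: "set Ks \<subseteq> carrier_mat e d"
  shows "cp_map d e (kraus_map e Ks)"
proof -
  have "psd (e * k) (tensor_supop d e (kraus_map e Ks) k k id X)" if "psd (d * k) X" for k X
    using that by (subst tensor_supop_kraus_map_id[OF Ks]) (auto intro!: psd_kraus_map[where d = "d * k"] dest: psd_carrier)
  then show ?thesis
    by (simp add: cp_map_def completely_positive_def linear_supop_kraus_map[OF Ks])
qed

section \<open>The channel and the switch\<close>

text \<open>
  On \<open>n\<close> qubits \<open>a \<mapsto> 2\<^sup>n - 1 - a\<close> is the bitwise complement, so \<open>flip_diag (2\<^sup>n)\<close> measures all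
  qubits in the computational basis and flips each of them.
\<close>

definition flip_diag :: "nat \<Rightarrow> supop" where
  "flip_diag N X = mat N N (\<lambda>(a, b). if a = b then X $$ (N - 1 - a, N - 1 - a) else 0)"

lemma flip_diag_dim [simp]: "dim_row (flip_diag N X) = N" "dim_col (flip_diag N X) = N"
  by (simp_all add: flip_diag_def)

lemma flip_diag_mat_unit_index:
  assumes "i < N" "j < N" "a < N" "b < N"
  shows "flip_diag N (mat_unit N i j) $$ (a, b) =
    of_bool (a = b) * of_bool (i = N - 1 - a \<and> j = N - 1 - a)"
  using assms by (simp add: flip_diag_def mat_unit_index)

text \<open>Complementing both digits of an index complements the index itself, so reversing the
  diagonal in each factor reverses it in the product.\<close>

lemma tensor_supop_flip_diag:
  assumes \<Phi>: "\<And>X. X \<in> carrier_mat d d \<Longrightarrow> \<Phi> X = flip_diag d X"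
    and \<Psi>: "\<And>X. X \<in> carrier_mat d' d' \<Longrightarrow> \<Psi> X = flip_diag d' X"
  shows "tensor_supop d d \<Phi> d' d' \<Psi> X = flip_diag (d * d') X"
proof (rule eq_matI)
  fix a b assume "a < dim_row (flip_diag (d * d') X)" "b < dim_col (flip_diag (d * d') X)"
  then have ab: "a < d * d'" "b < d * d'" by simp_all
  note m = div_mod_mult_less[OF ab(1)] div_mod_mult_less[OF ab(2)]
  have eq: "a = b \<longleftrightarrow> a div d' = b div d' \<and> a mod d' = b mod d'"
    by (metis div_mult_mod_eq)
  have flip: "(d - 1 - a div d') * d' + (d' - 1 - a mod d') = d * d' - 1 - a"
  proof -
    \<comment> \<open>\<open>u\<close> and \<open>v\<close> are the complements of the two digits;
      stating them additively avoids truncated subtraction.\<close>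
    obtain u where u: "d = a div d' + 1 + u" using m(1) by (metis add.commute less_iff_Suc_add plus_1_eq_Suc add_Suc_right)
    obtain v where v: "d' = a mod d' + 1 + v" using m(2) by (metis add.commute less_iff_Suc_add plus_1_eq_Suc add_Suc_right)
    have "(u * d' + v) + 1 + a = u * d' + (a mod d' + 1 + v) + a div d' * d'"
      using div_mult_mod_eq[of a d'] by linarith
    also have "\<dots> = (a div d' + 1 + u) * d'" using v by (simp add: algebra_simps)
    finally have "(u * d' + v) + 1 + a = d * d'" using u by simp
    moreover have "d - 1 - a div d' = u" "d' - 1 - a mod d' = v" using u v by linarith+
    ultimately show ?thesis by simp
  qed
  have "tensor_supop d d \<Phi> d' d' \<Psi> X $$ (a, b) =
     (\<Sum>i<d. \<Sum>j<d. (\<Sum>k<d'. \<Sum>l<d'. (X $$ (i * d' + k, j * d' + l) * of_bool (a = b)) *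
       of_bool (k = d' - 1 - a mod d' \<and> l = d' - 1 - a mod d')) *
       of_bool (i = d - 1 - a div d' \<and> j = d - 1 - a div d'))" (is "_ = ?rhs")
  proof -
    have "X $$ (i * d' + k, j * d' + l) *
        (\<Phi> (mat_unit d i j) $$ (a div d', b div d') * \<Psi> (mat_unit d' k l) $$ (a mod d', b mod d')) =
      (X $$ (i * d' + k, j * d' + l) * of_bool (a = b)) *
       of_bool (k = d' - 1 - a mod d' \<and> l = d' - 1 - a mod d') *
       of_bool (i = d - 1 - a div d' \<and> j = d - 1 - a div d')"
      if "i < d" "j < d" "k < d'" "l < d'" for i j k l
      using m ab that by (auto simp: \<Phi> \<Psi> flip_diag_mat_unit_index eq)
    note eq_term = this
    have "\<Phi> (mat_unit d i j) \<in> carrier_mat d d" "\<Psi> (mat_unit d' i j) \<in> carrier_mat d' d'" for i j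
      by (simp_all add: \<Phi> \<Psi> flip_diag_def)
    then have "tensor_supop d d \<Phi> d' d' \<Psi> X $$ (a, b) =
      (\<Sum>i<d. \<Sum>j<d. \<Sum>k<d'. \<Sum>l<d'. X $$ (i * d' + k, j * d' + l) *
        (\<Phi> (mat_unit d i j) $$ (a div d', b div d') * \<Psi> (mat_unit d' k l) $$ (a mod d', b mod d')))"
      using ab by (intro tensor_supop_index)
    also have "\<dots> = ?rhs" unfolding sum_distrib_right
      by (intro sum.cong refl eq_term) (simp_all only: lessThan_iff)
    finally show ?thesis .
  qed
  also have "\<dots> = (\<Sum>k<d'. \<Sum>l<d'. (X $$ ((d - 1 - a div d') * d' + k, (d - 1 - a div d') * d' + l) *
       of_bool (a = b)) * of_bool (k = d' - 1 - a mod d' \<and> l = d' - 1 - a mod d'))"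
    by (rule sum_delta2(1)) (use m in simp_all)
  also have "\<dots> = X $$ ((d - 1 - a div d') * d' + (d' - 1 - a mod d'),
       (d - 1 - a div d') * d' + (d' - 1 - a mod d')) * of_bool (a = b)"
    by (rule sum_delta2(1)) (use m in simp_all)
  also have "\<dots> = flip_diag (d * d') X $$ (a, b)"
    unfolding flip using ab by (simp add: flip_diag_def)
  finally show "tensor_supop d d \<Phi> d' d' \<Psi> X $$ (a, b) = flip_diag (d * d') X $$ (a, b)" .
qed simp_all

text \<open>Conjugation by X and by Y both exchange the diagonal entries, but they give the
  off-diagonal entries opposite signs, so these cancel.\<close>

lemma N_XY_eq_flip_diag:
  assumes "X \<in> carrier_mat 2 2"
  shows "N_XY X = flip_diag 2 X"
proof (rule eq_matI)
  fix a b assume "a < dim_row (flip_diag 2 X)" "b < dim_col (flip_diag 2 X)"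
  then have "a \<in> {0, 1}" "b \<in> {0, 1}" by auto
  then show "N_XY X $$ (a, b) = flip_diag 2 X $$ (a, b)"
    using assms
    by (auto simp: N_XY_def flip_diag_def pauli_X_def pauli_Y_def mat_of_rows_list_def
        scalar_prod_def numeral_2_eq_2 algebra_simps)
qed (simp_all add: N_XY_def pauli_Y_def mat_of_rows_list_def)

lemma supop_power_N_XY:
  assumes "X \<in> carrier_mat (2 ^ n) (2 ^ n)"
  shows "supop_power 2 N_XY n X = flip_diag (2 ^ n) X"
  using assms
proof (induction n arbitrary: X)
  \<comment> \<open>The empty power acts on dimension 1, whose single index is its own
    complement.\<close>
  case 0
  then show ?case by (intro eq_matI) (auto simp: flip_diag_def)
next
  case (Suc n)
  show ?case
    using tensor_supop_flip_diag[of 2 N_XY "2 ^ n" "supop_power 2 N_XY n", OF N_XY_eq_flip_diag Suc.IH]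
    by simp
qed

section \<open>Kraus representations of \<open>flip_diag\<close> and the sums met in the
  switch\<close>

lemma kraus_rep_cong:
  assumes "\<And>X. X \<in> carrier_mat d d \<Longrightarrow> \<Phi> X = \<Psi> X"
  shows "kraus_rep d e \<Phi> Ks \<longleftrightarrow> kraus_rep d e \<Psi> Ks"
  using assms by (auto simp: kraus_rep_def)

text \<open>Measuring p in the computational basis and preparing its complement has these Kraus
  operators. Their existence guarantees that \<open>SOME\<close> in the switch selects an actual
  representation.\<close>

lemma kraus_rep_flip_diag:
  "kraus_rep N N (flip_diag N) (map (\<lambda>p. mat_unit N (N - 1 - p) p) [0..<N])"
proof -
  have "flip_diag N X = kraus_map N (map (\<lambda>p. mat_unit N (N - 1 - p) p) [0..<N]) X" (is "_ = kraus_map N ?Ks X")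
    if X: "X \<in> carrier_mat N N" for X
  proof (rule eq_matI)
    fix a b assume "a < dim_row (kraus_map N ?Ks X)" "b < dim_col (kraus_map N ?Ks X)"
    then have ab: "a < N" "b < N" by simp_all
    have "(\<Sum>p<N. \<Sum>q<N. mat_unit N (N - 1 - k) k $$ (a, p) * X $$ (p, q) * cnj (mat_unit N (N - 1 - k) k $$ (b, q)))
       = (if k = N - 1 - a then X $$ (k, k) * of_bool (a = b) else 0)" if k: "k < N" for k
    proof -
      have "(\<Sum>p<N. \<Sum>q<N. mat_unit N (N - 1 - k) k $$ (a, p) * X $$ (p, q) * cnj (mat_unit N (N - 1 - k) k $$ (b, q)))
        = (\<Sum>p<N. \<Sum>q<N. (X $$ (p, q) * of_bool (N - 1 - k = a \<and> N - 1 - k = b)) * of_bool (k = p \<and> k = q))"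
        using k ab by (intro sum.cong refl) (auto simp: mat_unit_index)
      also have "\<dots> = X $$ (k, k) * of_bool (N - 1 - k = a \<and> N - 1 - k = b)"
        using k by (rule sum_delta2(2)[OF k])
      also have "\<dots> = (if k = N - 1 - a then X $$ (k, k) * of_bool (a = b) else 0)"
        using k ab by auto
      finally show ?thesis .
    qed
    note term_eq = this
    have "kraus_map N ?Ks X $$ (a, b) = (\<Sum>k<N. \<Sum>p<N. \<Sum>q<N. mat_unit N (N - 1 - k) k $$ (a, p) * X $$ (p, q) *
        cnj (mat_unit N (N - 1 - k) k $$ (b, q)))"
      using ab X by (subst kraus_map_index[of _ N N])
        (auto simp: o_def interv_sum_list_conv_sum_set_nat atLeast0LessThan)
    also have "\<dots> = (\<Sum>k<N. if k = N - 1 - a then X $$ (k, k) * of_bool (a = b) else 0)"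
      by (intro sum.cong refl term_eq) (simp only: lessThan_iff)
    also have "\<dots> = flip_diag N X $$ (a, b)"
      using ab by (simp add: flip_diag_def)
    finally show "flip_diag N X $$ (a, b) = kraus_map N ?Ks X $$ (a, b)" by simp
  qed simp_all
  then show ?thesis by (auto simp: kraus_rep_def)
qed

text \<open>
  The sum over a Kraus representation is an entry of the Choi matrix. The switch depends on the
  Kraus operators through such sums only, which makes its value independent of the
  representations chosen by \<open>SOME\<close>.
\<close>

lemma kraus_rep_flip_diag_sum:
  assumes "kraus_rep N N (flip_diag N) As" "a < N" "p < N" "s < N" "r < N"
  shows "(\<Sum>A\<leftarrow>As. A $$ (a, p) * cnj (A $$ (s, r))) = of_bool (s = a \<and> p = N - 1 - a \<and> r = N - 1 - a)"
proof -
  have "(\<Sum>A\<leftarrow>As. A $$ (a, p) * cnj (A $$ (s, r))) = kraus_map N As (mat_unit N p r) $$ (a, s)"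
    using assms by (subst kraus_map_mat_unit_index[of _ N N]) (simp_all add: kraus_rep_def)
  also have "\<dots> = flip_diag N (mat_unit N p r) $$ (a, s)"
    using assms(1) by (simp add: kraus_rep_def)
  also have "\<dots> = of_bool (s = a \<and> p = N - 1 - a \<and> r = N - 1 - a)"
    using assms by (auto simp: flip_diag_mat_unit_index)
  finally show ?thesis .
qed

text \<open>Once a summand is split into a part for A and a part for B, the two Kraus sums separate
  and each becomes a Choi entry.\<close>

lemma sum_list_sum_product:
  fixes \<rho> :: "nat \<Rightarrow> nat \<Rightarrow> complex"
  shows "(\<Sum>A\<leftarrow>As. \<Sum>B\<leftarrow>Bs. \<Sum>p\<in>P. \<Sum>q\<in>Q. \<Sum>m\<in>M. \<Sum>t\<in>T. \<rho> p q * (f A p q m t * g B p q m t)) =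
    (\<Sum>p\<in>P. \<Sum>q\<in>Q. \<Sum>m\<in>M. \<Sum>t\<in>T. \<rho> p q * ((\<Sum>A\<leftarrow>As. f A p q m t) * (\<Sum>B\<leftarrow>Bs. g B p q m t)))"
  by (simp only: sum_sum_list_swap[symmetric] sum_list_const_mult sum_list_mult_const)

text \<open>The A-sum forces \<open>b = a\<close> and sets both intermediate indices to the
  complement of \<open>a\<close>; the B-sum complements once more and returns to
  \<open>a\<close>.\<close>

lemma kraus_rep_flip_diag_same_order:
  assumes As: "kraus_rep N N (flip_diag N) As" and Bs: "kraus_rep N N (flip_diag N) Bs"
    and ab: "a < N" "b < N"
  shows "(\<Sum>A\<leftarrow>As. \<Sum>B\<leftarrow>Bs. \<Sum>p<N. \<Sum>q<N. (A * B) $$ (a, p) * \<rho> $$ (p, q) * cnj ((A * B) $$ (b, q))) =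
    (if b = a then \<rho> $$ (a, b) else 0)"
proof -
  have car: "A \<in> carrier_mat N N" "B \<in> carrier_mat N N" if "A \<in> set As" "B \<in> set Bs" for A B
    using As Bs that by (auto simp: kraus_rep_def)
  have "(\<Sum>p<N. \<Sum>q<N. (A * B) $$ (a, p) * \<rho> $$ (p, q) * cnj ((A * B) $$ (b, q))) =
    (\<Sum>p<N. \<Sum>q<N. \<Sum>m<N. \<Sum>t<N. \<rho> $$ (p, q) *
      ((A $$ (a, m) * cnj (A $$ (b, t))) * (B $$ (m, p) * cnj (B $$ (t, q)))))"
    if "A \<in> set As" "B \<in> set Bs" for A B
    using car[OF that] ab
    by (intro sum.cong refl) (simp add: mat_mult_index sum_product sum_distrib_left mult_ac del: index_mult_mat(1))
  then have "(\<Sum>A\<leftarrow>As. \<Sum>B\<leftarrow>Bs. \<Sum>p<N. \<Sum>q<N. (A * B) $$ (a, p) * \<rho> $$ (p, q) * cnj ((A * B) $$ (b, q))) =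
    (\<Sum>A\<leftarrow>As. \<Sum>B\<leftarrow>Bs. \<Sum>p<N. \<Sum>q<N. \<Sum>m<N. \<Sum>t<N. \<rho> $$ (p, q) *
      ((A $$ (a, m) * cnj (A $$ (b, t))) * (B $$ (m, p) * cnj (B $$ (t, q)))))"
    by (intro arg_cong[of _ _ sum_list] map_cong refl)
  also have "\<dots> = (\<Sum>p<N. \<Sum>q<N. \<Sum>m<N. \<Sum>t<N. \<rho> $$ (p, q) *
      ((\<Sum>A\<leftarrow>As. A $$ (a, m) * cnj (A $$ (b, t))) * (\<Sum>B\<leftarrow>Bs. B $$ (m, p) * cnj (B $$ (t, q)))))"
    by (rule sum_list_sum_product)
  also have "\<dots> = (\<Sum>p<N. \<Sum>q<N. \<Sum>m<N. \<Sum>t<N. (\<rho> $$ (p, q) * of_bool (b = a) *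
      of_bool (p = a \<and> q = a)) * of_bool (m = N - 1 - a \<and> t = N - 1 - a))"
    using ab by (intro sum.cong refl)
      (auto simp: kraus_rep_flip_diag_sum[OF As] kraus_rep_flip_diag_sum[OF Bs])
  also have "\<dots> = (\<Sum>p<N. \<Sum>q<N. \<rho> $$ (p, q) * of_bool (b = a) * of_bool (p = a \<and> q = a))"
    by (intro sum.cong refl sum_delta2(1)) (use ab in auto)
  also have "\<dots> = \<rho> $$ (a, a) * of_bool (b = a)"
    by (rule sum_delta2(1)) (use ab in auto)
  finally show ?thesis by simp
qed

text \<open>With the order reversed on the conjugated side, the intermediate index \<open>t\<close>
  is an output of A and an input of B. The A-sum forces \<open>t = a\<close> and sets
  \<open>m\<close> and \<open>q\<close> to the complement of \<open>a\<close>; the B-sum then forces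
  \<open>b = m\<close> and \<open>p = a\<close>. Hence the antidiagonal of \<open>\<rho>\<close>
  survives unchanged.\<close>

lemma kraus_rep_flip_diag_opposite_order:
  assumes As: "kraus_rep N N (flip_diag N) As" and Bs: "kraus_rep N N (flip_diag N) Bs"
    and ab: "a < N" "b < N"
  shows "(\<Sum>A\<leftarrow>As. \<Sum>B\<leftarrow>Bs. \<Sum>p<N. \<Sum>q<N. (A * B) $$ (a, p) * \<rho> $$ (p, q) * cnj ((B * A) $$ (b, q))) =
    (if b = N - 1 - a then \<rho> $$ (a, b) else 0)"
proof -
  have car: "A \<in> carrier_mat N N" "B \<in> carrier_mat N N" if "A \<in> set As" "B \<in> set Bs" for A B
    using As Bs that by (auto simp: kraus_rep_def)
  have "(\<Sum>p<N. \<Sum>q<N. (A * B) $$ (a, p) * \<rho> $$ (p, q) * cnj ((B * A) $$ (b, q))) =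
    (\<Sum>p<N. \<Sum>q<N. \<Sum>m<N. \<Sum>t<N. \<rho> $$ (p, q) *
      ((A $$ (a, m) * cnj (A $$ (t, q))) * (B $$ (m, p) * cnj (B $$ (b, t)))))"
    if "A \<in> set As" "B \<in> set Bs" for A B
    using car[OF that] ab
    by (intro sum.cong refl) (simp add: mat_mult_index sum_product sum_distrib_left mult_ac del: index_mult_mat(1))
  then have "(\<Sum>A\<leftarrow>As. \<Sum>B\<leftarrow>Bs. \<Sum>p<N. \<Sum>q<N. (A * B) $$ (a, p) * \<rho> $$ (p, q) * cnj ((B * A) $$ (b, q))) =
    (\<Sum>A\<leftarrow>As. \<Sum>B\<leftarrow>Bs. \<Sum>p<N. \<Sum>q<N. \<Sum>m<N. \<Sum>t<N. \<rho> $$ (p, q) *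
      ((A $$ (a, m) * cnj (A $$ (t, q))) * (B $$ (m, p) * cnj (B $$ (b, t)))))"
    by (intro arg_cong[of _ _ sum_list] map_cong refl)
  also have "\<dots> = (\<Sum>p<N. \<Sum>q<N. \<Sum>m<N. \<Sum>t<N. \<rho> $$ (p, q) *
      ((\<Sum>A\<leftarrow>As. A $$ (a, m) * cnj (A $$ (t, q))) * (\<Sum>B\<leftarrow>Bs. B $$ (m, p) * cnj (B $$ (b, t)))))"
    by (rule sum_list_sum_product)
  also have "\<dots> = (\<Sum>p<N. \<Sum>q<N. \<Sum>m<N. \<Sum>t<N. (\<rho> $$ (p, q) * of_bool (b = N - 1 - a) *
      of_bool (p = a \<and> q = N - 1 - a)) * of_bool (m = N - 1 - a \<and> t = a))"
    using ab by (intro sum.cong refl)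
      (auto simp: kraus_rep_flip_diag_sum[OF As] kraus_rep_flip_diag_sum[OF Bs])
  also have "\<dots> = (\<Sum>p<N. \<Sum>q<N. \<rho> $$ (p, q) * of_bool (b = N - 1 - a) * of_bool (p = a \<and> q = N - 1 - a))"
    by (intro sum.cong refl sum_delta2(1)) (use ab in auto)
  also have "\<dots> = \<rho> $$ (a, N - 1 - a) * of_bool (b = N - 1 - a)"
    by (rule sum_delta2(1)) (use ab in auto)
  finally show ?thesis by simp
qed

section \<open>Entries of the switched state\<close>

lemma sum_list_concat_map:
  "(\<Sum>z\<leftarrow>concat (map (\<lambda>x. map (h x) ys) xs). f z) = (\<Sum>x\<leftarrow>xs. \<Sum>y\<leftarrow>ys. (f (h x y) :: 'a::comm_monoid_add))"
  by (induction xs) (simp_all add: o_def)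

lemma sum_list_swap:
  "(\<Sum>x\<leftarrow>xs. \<Sum>y\<leftarrow>ys. (f x y :: 'a::comm_monoid_add)) = (\<Sum>y\<leftarrow>ys. \<Sum>x\<leftarrow>xs. f x y)"
  by (induction xs) (simp_all add: sum_list_addf)

text \<open>The order qubit is the right factor, hence the last digit. The operator is block
  diagonal in it, and the digit selects the order of the product.\<close>

lemma switch_kraus_block:
  assumes "A \<in> carrier_mat N N" "B \<in> carrier_mat N N" "a < N" "p < N" "c < 2" "f < 2"
  shows "((A * B) \<otimes>\<^sub>m ketbra ket0 ket0 + (B * A) \<otimes>\<^sub>m ketbra ket1 ket1) $$ (a * 2 + c, p * 2 + f) =
    (if c = 0 then A * B else B * A) $$ (a, p) * of_bool (c = f)"
proof -
  have dims: "dim_row (ketbra ket0 ket0) = 2" "dim_col (ketbra ket0 ket0) = 2"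
    "dim_row (ketbra ket1 ket1) = 2" "dim_col (ketbra ket1 ket1) = 2"
    by (simp_all add: ketbra_def ket0_def ket1_def)
  have bounds: "a * 2 + c < N * 2" "p * 2 + f < N * 2"
    using assms by simp_all
  have "c \<in> {0, 1}" "f \<in> {0, 1}" using assms by auto
  then show ?thesis
    using assms(1,2) bounds
    by (auto simp: tensor_mat_def dims ketbra_def ket0_def ket1_def)
qed

text \<open>The order digits pass through unchanged and leave the factor
  \<open>\<omega> $$ (c, c')\<close>. Equal digits pair a product with itself, different digits pair
  the two orders.\<close>

lemma switched_channel_flip_diag:
  assumes \<Phi>: "\<And>X. X \<in> carrier_mat N N \<Longrightarrow> \<Phi> X = flip_diag N X"
    and \<Psi>: "\<And>X. X \<in> carrier_mat N N \<Longrightarrow> \<Psi> X = flip_diag N X"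
    and \<rho>: "\<rho> \<in> carrier_mat N N" and \<omega>: "\<omega> \<in> carrier_mat 2 2"
    and ab: "a < N" "b < N" and cc: "c < 2" "c' < 2"
  shows "switched_channel N \<omega> \<Phi> \<Psi> \<rho> $$ (a * 2 + c, b * 2 + c') =
    \<omega> $$ (c, c') * (if b = (if c = c' then a else N - 1 - a) then \<rho> $$ (a, b) else 0)"
proof -
  define As where "As = (SOME As. kraus_rep N N \<Phi> As)"
  define Bs where "Bs = (SOME Bs. kraus_rep N N \<Psi> Bs)"
  \<comment> \<open>Being a Kraus representation depends only on values in L(C^N), so the selected
    lists also represent \<open>flip_diag N\<close>.\<close>
  have kraus_rep: "kraus_rep N N \<Phi> = kraus_rep N N (flip_diag N)" "kraus_rep N N \<Psi> = kraus_rep N N (flip_diag N)"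
    by (intro ext kraus_rep_cong \<Phi> \<Psi>; assumption)+
  have As: "kraus_rep N N (flip_diag N) As" and Bs: "kraus_rep N N (flip_diag N) Bs"
    unfolding As_def Bs_def kraus_rep by (rule someI, rule kraus_rep_flip_diag)+
  have car: "A \<in> carrier_mat N N" "B \<in> carrier_mat N N" if "A \<in> set As" "B \<in> set Bs" for A B
    using As Bs that by (auto simp: kraus_rep_def)
  define S where "S = (\<lambda>A B. (A * B) \<otimes>\<^sub>m ketbra ket0 ket0 + (B * A) \<otimes>\<^sub>m ketbra ket1 ket1)"
  \<comment> \<open>\<open>C c A B\<close> is the product in the order selected by the order
    digit.\<close>
  define C where "C = (\<lambda>c A B. if c = (0 :: nat) then A * B else B * (A :: complex mat))"
  have S_car: "S A B \<in> carrier_mat (N * 2) (N * 2)" if "A \<in> set As" "B \<in> set Bs" for A B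
    unfolding S_def using car[OF that]
    by (intro carrier_matI) (simp_all add: tensor_mat_def ketbra_def ket1_def)
  have term_eq: "(\<Sum>x<N * 2. \<Sum>y<N * 2. S A B $$ (a * 2 + c, x) * (\<rho> \<otimes>\<^sub>m \<omega>) $$ (x, y) * cnj (S A B $$ (b * 2 + c', y)))
    = \<omega> $$ (c, c') * (\<Sum>p<N. \<Sum>q<N. C c A B $$ (a, p) * \<rho> $$ (p, q) * cnj (C c' A B $$ (b, q)))"
    if AB: "A \<in> set As" "B \<in> set Bs" for A B
  proof -
    have "(\<Sum>x<N * 2. \<Sum>y<N * 2. S A B $$ (a * 2 + c, x) * (\<rho> \<otimes>\<^sub>m \<omega>) $$ (x, y) * cnj (S A B $$ (b * 2 + c', y)))
      = (\<Sum>p<N. \<Sum>f<2. \<Sum>q<N. \<Sum>f'<2. S A B $$ (a * 2 + c, p * 2 + f) *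
          (\<rho> \<otimes>\<^sub>m \<omega>) $$ (p * 2 + f, q * 2 + f') * cnj (S A B $$ (b * 2 + c', q * 2 + f')))"
      by (simp only: sum_mult_split)
    also have "\<dots> = (\<Sum>p<N. \<Sum>q<N. \<Sum>f<2. \<Sum>f'<2. S A B $$ (a * 2 + c, p * 2 + f) *
          (\<rho> \<otimes>\<^sub>m \<omega>) $$ (p * 2 + f, q * 2 + f') * cnj (S A B $$ (b * 2 + c', q * 2 + f')))"
      by (intro sum.cong refl sum.swap)
    also have "\<dots> = (\<Sum>p<N. \<Sum>q<N. \<Sum>f<2. \<Sum>f'<2. (\<omega> $$ (f, f') *
        (C c A B $$ (a, p) * \<rho> $$ (p, q) * cnj (C c' A B $$ (b, q)))) * of_bool (c = f \<and> c' = f'))"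
    proof (intro sum.cong refl)
      fix p q f f' :: nat
      assume "p \<in> {..<N}" "q \<in> {..<N}" "f \<in> {..<2}" "f' \<in> {..<2}"
      then have b: "p < N" "q < N" "f < 2" "f' < 2" by simp_all
      have "S A B $$ (a * 2 + c, p * 2 + f) = C c A B $$ (a, p) * of_bool (c = f)"
        unfolding S_def C_def by (rule switch_kraus_block) (use car[OF AB] ab cc b in simp_all)
      moreover have "S A B $$ (b * 2 + c', q * 2 + f') = C c' A B $$ (b, q) * of_bool (c' = f')"
        unfolding S_def C_def by (rule switch_kraus_block) (use car[OF AB] ab cc b in simp_all)
      moreover have "(\<rho> \<otimes>\<^sub>m \<omega>) $$ (p * 2 + f, q * 2 + f') = \<rho> $$ (p, q) * \<omega> $$ (f, f')"
        using b by (subst tensor_mat_index[OF \<rho> \<omega>]) simp_all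
      ultimately show "S A B $$ (a * 2 + c, p * 2 + f) *
          (\<rho> \<otimes>\<^sub>m \<omega>) $$ (p * 2 + f, q * 2 + f') * cnj (S A B $$ (b * 2 + c', q * 2 + f')) =
        (\<omega> $$ (f, f') * (C c A B $$ (a, p) * \<rho> $$ (p, q) * cnj (C c' A B $$ (b, q)))) * of_bool (c = f \<and> c' = f')"
        by simp
    qed
    also have "\<dots> = (\<Sum>p<N. \<Sum>q<N. \<omega> $$ (c, c') *
        (C c A B $$ (a, p) * \<rho> $$ (p, q) * cnj (C c' A B $$ (b, q))))"
      by (intro sum.cong refl sum_delta2(2) cc)
    finally show ?thesis by (simp only: sum_distrib_left)
  qed
  have "switched_channel N \<omega> \<Phi> \<Psi> \<rho> = kraus_map (N * 2) (concat (map (\<lambda>A. map (S A) Bs) As)) (\<rho> \<otimes>\<^sub>m \<omega>)"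
    by (simp add: switched_channel_def quantum_switch_def switch_kraus_def As_def Bs_def S_def)
  also have "\<dots> $$ (a * 2 + c, b * 2 + c') = (\<Sum>A\<leftarrow>As. \<Sum>B\<leftarrow>Bs. \<Sum>x<N * 2. \<Sum>y<N * 2.
       S A B $$ (a * 2 + c, x) * (\<rho> \<otimes>\<^sub>m \<omega>) $$ (x, y) * cnj (S A B $$ (b * 2 + c', y)))"
    by (rule trans[OF kraus_map_index sum_list_concat_map])
      (use ab cc S_car tensor_mat_carrier[OF \<rho> \<omega>] in auto)
  also have "\<dots> = (\<Sum>A\<leftarrow>As. \<Sum>B\<leftarrow>Bs. \<omega> $$ (c, c') *
      (\<Sum>p<N. \<Sum>q<N. C c A B $$ (a, p) * \<rho> $$ (p, q) * cnj (C c' A B $$ (b, q))))"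
    by (intro arg_cong[of _ _ sum_list] map_cong refl term_eq)
  also have "\<dots> = \<omega> $$ (c, c') * (\<Sum>A\<leftarrow>As. \<Sum>B\<leftarrow>Bs.
      (\<Sum>p<N. \<Sum>q<N. C c A B $$ (a, p) * \<rho> $$ (p, q) * cnj (C c' A B $$ (b, q))))"
    by (simp only: sum_list_const_mult)
  also have "(\<Sum>A\<leftarrow>As. \<Sum>B\<leftarrow>Bs. (\<Sum>p<N. \<Sum>q<N. C c A B $$ (a, p) * \<rho> $$ (p, q) * cnj (C c' A B $$ (b, q)))) =
      (if b = (if c = c' then a else N - 1 - a) then \<rho> $$ (a, b) else 0)"
  proof -
    have "c \<in> {0, 1}" "c' \<in> {0, 1}" using cc by auto
    then consider "c = 0" "c' = 0" | "c = 0" "c' = 1" | "c = 1" "c' = 0" | "c = 1" "c' = 1" by blast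
    then show ?thesis
    proof cases
      case 1
      show ?thesis unfolding 1 C_def using kraus_rep_flip_diag_same_order[OF As Bs ab, of \<rho>] by simp
    next
      case 2
      show ?thesis unfolding 2 C_def using kraus_rep_flip_diag_opposite_order[OF As Bs ab, of \<rho>] by simp
    next
      case 3
      \<comment> \<open>The unconjugated product is now B A, so the lists exchange roles and the two
        list sums are swapped to match.\<close>
      show ?thesis unfolding 3 C_def using kraus_rep_flip_diag_opposite_order[OF Bs As ab, of \<rho>]
        by (subst sum_list_swap) simp
    next
      case 4
      show ?thesis unfolding 4 C_def using kraus_rep_flip_diag_same_order[OF Bs As ab, of \<rho>]
        by (subst sum_list_swap) simp
    qed
  qed
  finally show ?thesis .
qed

section \<open>The repetition code and its local decoding\<close>

text \<open>For \<open>\<epsilon> = \<plusminus>1\<close> this is conjugation by \<open>diag(1, \<epsilon>)\<close>: the identity or the phase flip.\<close>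

definition offdiag_scale :: "complex \<Rightarrow> complex mat \<Rightarrow> complex mat" where
  "offdiag_scale \<epsilon> \<rho> = mat 2 2 (\<lambda>(p, q). if p = q then \<rho> $$ (p, q) else \<epsilon> * \<rho> $$ (p, q))"

text \<open>
  Conjugation by the isometry \<open>|0\<rangle> \<mapsto> |0\<dots>0\<rangle>, |1\<rangle> \<mapsto> |1\<dots>1\<rangle>\<close>, whatever the number of remaining
  qubits: \<open>D\<close> is the total dimension and \<open>|1\<dots>1\<rangle>\<close> has index \<open>D - 1\<close>.
\<close>

definition repetition_code :: "nat \<Rightarrow> supop" where
  "repetition_code D \<rho> = mat D D (\<lambda>(a, b).
     if {a, b} \<subseteq> {0, D - 1} then \<rho> $$ (of_bool (a \<noteq> 0), of_bool (b \<noteq> 0)) else 0)"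

text \<open>For signs 1 and -1 these are the states |+> and |->; labelling them by sign lets
  outcomes accumulate as a product.\<close>

definition sign_vec :: "complex \<Rightarrow> complex vec" where
  "sign_vec \<epsilon> = complex_of_real (1 / sqrt 2) \<cdot>\<^sub>v vec 2 (\<lambda>c. if c = 0 then 1 else \<epsilon>)"

lemma repetition_code_dim [simp]:
  "dim_row (repetition_code D \<rho>) = D" "dim_col (repetition_code D \<rho>) = D"
  by (simp_all add: repetition_code_def)

lemma repetition_code_carrier [simp]: "repetition_code D \<rho> \<in> carrier_mat D D"
  by (intro carrier_matI) simp_all

lemma offdiag_scale_dim [simp]:
  "dim_row (offdiag_scale \<epsilon> \<rho>) = 2" "dim_col (offdiag_scale \<epsilon> \<rho>) = 2"
  by (simp_all add: offdiag_scale_def)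

lemma offdiag_scale_carrier [simp]: "offdiag_scale \<epsilon> \<rho> \<in> carrier_mat 2 2"
  by (intro carrier_matI) simp_all

lemma sign_vec_dim [simp]: "dim_vec (sign_vec \<epsilon>) = 2"
  by (simp add: sign_vec_def)

lemma sign_vec_product:
  assumes "\<epsilon> \<in> {1, -1}" "c < 2" "c' < 2"
  shows "sign_vec \<epsilon> $ c * cnj (sign_vec \<epsilon> $ c') = (if c = c' then 1 / 2 else \<epsilon> / 2)"
proof -
  have "complex_of_real (1 / sqrt 2) * complex_of_real (1 / sqrt 2) = 1 / 2"
    by (simp only: of_real_mult[symmetric]) (simp add: real_sqrt_mult[symmetric])
  moreover have "c \<in> {0, 1}" "c' \<in> {0, 1}" using assms by auto
  ultimately show ?thesis using assms(1)
    by (auto simp: sign_vec_def)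
qed

section \<open>Local operations in coordinates and the instruments of the receivers\<close>

lemma sum_lessThan_2: "(\<Sum>c<2. f c) = f 0 + (f (1::nat) :: 'a::comm_monoid_add)"
  by (simp add: numeral_2_eq_2)

text \<open>An index has three digits: for the parties before \<open>i\<close>, for party
  \<open>i\<close>, and for those after it. The identities fix the outer two, so only the digit of
  party \<open>i\<close> is summed over.\<close>

lemma local_supop_index:
  assumes J: "\<And>p q. p < d \<Longrightarrow> q < d \<Longrightarrow> J (mat_unit d p q) \<in> carrier_mat e e"
    and d: "ds ! i = d" and l: "prod_list (take i ds) = l" and r: "prod_list (drop (Suc i) ds) = r"
    and ab: "a < l * (e * r)" "b < l * (e * r)"
  shows "local_supop ds i e J R $$ (a, b) = (\<Sum>p<d. \<Sum>q<d.
    R $$ ((a div (e * r)) * (d * r) + (p * r + a mod r), (b div (e * r)) * (d * r) + (q * r + b mod r)) *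
    J (mat_unit d p q) $$ ((a mod (e * r)) div r, (b mod (e * r)) div r))"
proof -
  note m = div_mod_mult_less[OF ab(1)] div_mod_mult_less[OF ab(2)]
  have r0: "0 < r" using ab by (auto intro: gr0I)
  let ?a = "a mod (e * r)" and ?b = "b mod (e * r)"
  let ?R = "\<lambda>x y. R $$ ((a div (e * r)) * (d * r) + x, (b div (e * r)) * (d * r) + y)"
  have modr: "?a mod r = a mod r" "?b mod r = b mod r"
    by (simp_all add: mod_mod_cancel)
  have "local_supop ds i e J R $$ (a, b) = (\<Sum>x<d * r. \<Sum>y<d * r. ?R x y *
      tensor_supop d e J r r id (mat_unit (d * r) x y) $$ (?a, ?b))"
    unfolding local_supop_def Let_def d l r
    by (rule tensor_supop_id_left_index) (use ab in simp_all)
  also have "\<dots> = (\<Sum>x<d * r. \<Sum>y<d * r. \<Sum>p<d. \<Sum>q<d.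
      (?R x y * J (mat_unit d p q) $$ (?a div r, ?b div r)) *
      of_bool (x = p * r + a mod r \<and> y = q * r + b mod r))"
  proof (intro sum.cong refl)
    fix x y assume "x \<in> {..<d * r}" "y \<in> {..<d * r}"
    then have xy: "x < d * r" "y < d * r" by simp_all
    have "tensor_supop d e J r r id (mat_unit (d * r) x y) $$ (?a, ?b) =
      (\<Sum>p<d. \<Sum>q<d. mat_unit (d * r) x y $$ (p * r + ?a mod r, q * r + ?b mod r) *
         J (mat_unit d p q) $$ (?a div r, ?b div r))"
      by (rule tensor_supop_id_right_index) (use m J in simp_all)
    also have "\<dots> = (\<Sum>p<d. \<Sum>q<d. J (mat_unit d p q) $$ (?a div r, ?b div r) *
        of_bool (x = p * r + a mod r \<and> y = q * r + b mod r))"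
    proof (intro sum.cong refl)
      fix p q assume "p \<in> {..<d}" "q \<in> {..<d}"
      then have "p * r + a mod r < d * r" "q * r + b mod r < d * r"
        using r0 by (auto intro: index_lt_mult)
      then show "mat_unit (d * r) x y $$ (p * r + ?a mod r, q * r + ?b mod r) *
         J (mat_unit d p q) $$ (?a div r, ?b div r) = J (mat_unit d p q) $$ (?a div r, ?b div r) *
        of_bool (x = p * r + a mod r \<and> y = q * r + b mod r)"
        using xy by (simp add: modr mat_unit_index)
    qed
    finally show "?R x y * tensor_supop d e J r r id (mat_unit (d * r) x y) $$ (?a, ?b) =
      (\<Sum>p<d. \<Sum>q<d. (?R x y * J (mat_unit d p q) $$ (?a div r, ?b div r)) *
        of_bool (x = p * r + a mod r \<and> y = q * r + b mod r))"
      by (simp only: sum_distrib_left mult.assoc)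
  qed
  \<comment> \<open>With the sums over x and y innermost, the delta pins them to the index with
    middle digit p or q.\<close>
  also have "\<dots> = (\<Sum>p<d. \<Sum>q<d. \<Sum>x<d * r. \<Sum>y<d * r.
      (?R x y * J (mat_unit d p q) $$ (?a div r, ?b div r)) *
      of_bool (x = p * r + a mod r \<and> y = q * r + b mod r))"
    by (rule sum_swap_pairs)
  also have "\<dots> = (\<Sum>p<d. \<Sum>q<d. ?R (p * r + a mod r) (q * r + b mod r) *
      J (mat_unit d p q) $$ (?a div r, ?b div r))"
    by (intro sum.cong refl sum_delta2(1)) (use r0 in \<open>auto intro: index_lt_mult\<close>)
  finally show ?thesis .
qed

lemma local_supop_dim [simp]:
  "dim_row (local_supop ds i e J R) = prod_list (take i ds) * (e * prod_list (drop (Suc i) ds))"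
  "dim_col (local_supop ds i e J R) = prod_list (take i ds) * (e * prod_list (drop (Suc i) ds))"
  by (simp_all add: local_supop_def Let_def)

text \<open>The one Kraus operator is the bra of \<open>sign_vec \<epsilon>\<close>, whose entries
  are real for real \<open>\<epsilon>\<close>; output dimension 1 discards the measured
  qubit.\<close>

definition sign_measurement :: "complex \<Rightarrow> supop" where
  "sign_measurement \<epsilon> = kraus_map 1 [mat 1 2 (\<lambda>(i, j). sign_vec \<epsilon> $ j)]"

definition phase_map :: "complex \<Rightarrow> supop" where
  "phase_map \<epsilon> = kraus_map 2 [mat 2 2 (\<lambda>(i, j). if i = j then (if i = 0 then 1 else \<epsilon>) else 0)]"

lemma sign_measurement_index:
  assumes "\<epsilon> \<in> {1, -1}" "X \<in> carrier_mat 2 2"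
  shows "sign_measurement \<epsilon> X $$ (0, 0) = (\<Sum>p<2. \<Sum>q<2. X $$ (p, q) * (if p = q then 1 / 2 else \<epsilon> / 2))"
proof -
  have "sign_measurement \<epsilon> X $$ (0, 0) =
      (\<Sum>p<2. \<Sum>q<2. X $$ (p, q) * (sign_vec \<epsilon> $ p * cnj (sign_vec \<epsilon> $ q)))"
    unfolding sign_measurement_def using assms
    by (subst kraus_map_index[of _ _ 2]) (auto intro!: sum.cong simp: mult_ac)
  also have "\<dots> = (\<Sum>p<2. \<Sum>q<2. X $$ (p, q) * (if p = q then 1 / 2 else \<epsilon> / 2))"
    by (intro sum.cong refl) (simp only: sign_vec_product[OF assms(1)] lessThan_iff)
  finally show ?thesis .
qed

lemma sign_measurement_mat_unit:
  assumes "\<epsilon> \<in> {1, -1}" "p < 2" "q < 2"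
  shows "sign_measurement \<epsilon> (mat_unit 2 p q) $$ (0, 0) = (if p = q then 1 / 2 else \<epsilon> / 2)"
proof -
  have "sign_measurement \<epsilon> (mat_unit 2 p q) $$ (0, 0) =
    (\<Sum>p'<2. \<Sum>q'<2. (if p' = q' then 1 / 2 else \<epsilon> / 2) * of_bool (p = p' \<and> q = q'))"
    unfolding sign_measurement_index[OF assms(1) mat_unit_carrier]
    by (intro sum.cong refl) (use assms in \<open>simp add: mat_unit_index\<close>)
  also have "\<dots> = (if p = q then 1 / 2 else \<epsilon> / 2)"
    by (rule sum_delta2(2)) (use assms in simp_all)
  finally show ?thesis .
qed

text \<open>Each outcome takes half of the trace plus or minus an off-diagonal contribution; the
  latter cancels between the two outcomes.\<close>

lemma instrument_sign_measurement:
  shows "instrument 2 2 (\<lambda>_. 1) (\<lambda>k. sign_measurement (if k = 0 then 1 else -1))"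
proof -
  have "cp_map 2 1 (sign_measurement \<epsilon>)" for \<epsilon>
    unfolding sign_measurement_def by (rule cp_map_kraus_map) auto
  moreover have "(\<Sum>k<2. tr (sign_measurement (if k = (0::nat) then 1 else -1) A)) = tr A"
    if "A \<in> carrier_mat 2 2" for A
  proof -
    have "tr (sign_measurement \<epsilon> A) = sign_measurement \<epsilon> A $$ (0, 0)" for \<epsilon>
      by (simp add: tr_def sign_measurement_def)
    then show ?thesis using that
      by (simp add: sum_lessThan_2 sign_measurement_index tr_def)
  qed
  ultimately show ?thesis by (simp add: instrument_def)
qed

text \<open>The Kraus form yields complete positivity and the entrywise form the computations. They
  agree because a sign squares to 1.\<close>

lemma phase_map_eq:
  assumes "\<epsilon> \<in> {1, -1}" "X \<in> carrier_mat 2 2"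
  shows "phase_map \<epsilon> X = offdiag_scale \<epsilon> X"
proof (rule eq_matI)
  fix a b assume "a < dim_row (offdiag_scale \<epsilon> X)" "b < dim_col (offdiag_scale \<epsilon> X)"
  then have "a \<in> {0, 1}" "b \<in> {0, 1}" by auto
  then show "phase_map \<epsilon> X $$ (a, b) = offdiag_scale \<epsilon> X $$ (a, b)"
    unfolding phase_map_def using assms
    by (subst kraus_map_index[of _ _ 2]) (auto simp: sum_lessThan_2 offdiag_scale_def)
qed (simp_all add: phase_map_def)

lemma instrument_phase_map:
  assumes "\<epsilon> \<in> {1, -1}"
  shows "instrument 2 1 (\<lambda>_. 2) (\<lambda>_. phase_map \<epsilon>)"
proof -
  have "cp_map 2 2 (phase_map \<epsilon>)"
    unfolding phase_map_def by (rule cp_map_kraus_map) auto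
  moreover have "tr (phase_map \<epsilon> A) = tr A" if "A \<in> carrier_mat 2 2" for A
    using that by (simp add: phase_map_eq[OF assms] tr_def sum_lessThan_2 offdiag_scale_def)
  ultimately show ?thesis by (simp add: instrument_def)
qed

text \<open>Applying the bra to one qubit of |0...0> or |1...1> leaves the shorter code word, times
  1/sqrt 2 and, for the latter word, \<open>\<epsilon>\<close>. The condition
  \<open>2 \<le> l * r\<close> keeps the two shorter code words distinct.\<close>

lemma local_supop_sign_measurement:
  assumes \<epsilon>: "\<epsilon> \<in> {1, -1}" and \<rho>: "\<rho> \<in> carrier_mat 2 2"
    and d: "ds ! i = 2" and l: "prod_list (take i ds) = l" and r: "prod_list (drop (Suc i) ds) = r"
    and lr: "2 \<le> l * r"
  shows "local_supop ds i 1 (sign_measurement \<epsilon>) (repetition_code (l * 2 * r) \<rho>) =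
    repetition_code (l * r) ((1 / 2) \<cdot>\<^sub>m offdiag_scale \<epsilon> \<rho>)" (is "?L = ?R")
proof (rule eq_matI)
  fix a b assume "a < dim_row ?R" "b < dim_col ?R"
  then have ab: "a < l * r" "b < l * r" by simp_all
  have r0: "0 < r" using lr by (auto intro: gr0I)
  \<comment> \<open>\<open>x a p\<close> inserts p as the digit of party \<open>i\<close> into the
    index \<open>a\<close> of the remaining systems.\<close>
  define x where "x = (\<lambda>a p. (a div r) * (2 * r) + (p * r + a mod r))"
  have x0: "x a p = 0 \<longleftrightarrow> p = 0 \<and> a = 0" if "a < l * r" for a p
    using r0 that by (auto simp: x_def)
  have x1: "x a p = l * 2 * r - 1 \<longleftrightarrow> p = 1 \<and> a = l * r - 1" and xless: "x a p < l * 2 * r"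
    if a: "a < l * r" and p: "p < 2" for a p
  proof -
    note m = div_mod_mult_less[OF a]
    \<comment> \<open>\<open>u\<close>, \<open>v\<close> and \<open>w\<close> measure how far each
      digit lies below its maximum; an index is the last one exactly when all these gaps
      vanish.\<close>
    obtain u where u: "l = a div r + 1 + u" using m(1) by (metis add.commute less_iff_Suc_add plus_1_eq_Suc add_Suc_right)
    obtain v where v: "r = a mod r + 1 + v" using m(2) by (metis add.commute less_iff_Suc_add plus_1_eq_Suc add_Suc_right)
    obtain w where w: "2 = p + 1 + w" using p by (metis add.commute less_iff_Suc_add plus_1_eq_Suc add_Suc_right)
    have "l * 2 * r = (a div r) * (2 * r) + u * (2 * r) + (p + 1 + w) * r"
    proof -
      have "l * 2 * r = (a div r) * (2 * r) + u * (2 * r) + 2 * r"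
        by (subst u) (simp add: algebra_simps)
      then show ?thesis by (simp only: w[symmetric])
    qed
    also have "\<dots> = (a div r) * (2 * r) + u * (2 * r) + p * r + w * r + (a mod r + 1 + v)"
      using v by (simp add: algebra_simps)
    also have "\<dots> = x a p + 1 + (u * (2 * r) + w * r + v)"
      by (simp add: x_def)
    finally have X: "l * 2 * r = x a p + 1 + (u * (2 * r) + w * r + v)" .
    have "l * r = (a div r) * r + u * r + r" by (subst u) (simp add: algebra_simps)
    also have "\<dots> = a + 1 + (u * r + v)"
      using v div_mult_mod_eq[of a r] by linarith
    finally have A: "l * r = a + 1 + (u * r + v)" .
    show "x a p < l * 2 * r" using X by simp
    have "x a p = l * 2 * r - 1 \<longleftrightarrow> u = 0 \<and> w = 0 \<and> v = 0" using X r0 by auto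
    moreover have "a = l * r - 1 \<longleftrightarrow> u = 0 \<and> v = 0" using A r0 by auto
    moreover have "w = 0 \<longleftrightarrow> p = 1" using w by linarith
    ultimately show "x a p = l * 2 * r - 1 \<longleftrightarrow> p = 1 \<and> a = l * r - 1" by blast
  qed
  \<comment> \<open>\<open>?g\<close> recognises the indices of the two code words and
    \<open>?f\<close> reads off the logical bit.\<close>
  let ?g = "\<lambda>a. a \<in> {0, l * r - 1}" and ?f = "\<lambda>a. of_bool (a \<noteq> (0::nat)) :: nat"
  have code: "repetition_code (l * 2 * r) \<rho> $$ (x a p, x b q) =
     \<rho> $$ (p, q) * of_bool (?g a \<and> ?g b) * of_bool (p = ?f a \<and> q = ?f b)" if "p < 2" "q < 2" for p q
  proof -
    have "x a p \<in> {0, l * 2 * r - 1} \<longleftrightarrow> ?g a \<and> p = ?f a" "x b q \<in> {0, l * 2 * r - 1} \<longleftrightarrow> ?g b \<and> q = ?f b"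
      using x0[OF ab(1), of p] x0[OF ab(2), of q] x1[OF ab(1) that(1)] x1[OF ab(2) that(2)] lr that
      by auto
    moreover have "of_bool (x a p \<noteq> 0) = p" if "?g a" "p = ?f a" 
      using that x0[OF ab(1), of p] by auto
    moreover have "of_bool (x b q \<noteq> 0) = q" if "?g b" "q = ?f b" 
      using that x0[OF ab(2), of q] by auto
    ultimately show ?thesis
      using xless[OF ab(1) that(1)] xless[OF ab(2) that(2)]
      by (auto simp: repetition_code_def)
  qed
  \<comment> \<open>The measured system has dimension 1, so its output digit is 0.\<close>
  have "?L $$ (a, b) = (\<Sum>p<2. \<Sum>q<2. repetition_code (l * 2 * r) \<rho> $$ (x a p, x b q) *
     sign_measurement \<epsilon> (mat_unit 2 p q) $$ (0, 0))"
    using ab r0 by (subst local_supop_index[OF _ d l r]) (simp_all add: x_def sign_measurement_def)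
  also have "\<dots> = (\<Sum>p<2. \<Sum>q<2. (\<rho> $$ (p, q) * of_bool (?g a \<and> ?g b) * (if p = q then 1 / 2 else \<epsilon> / 2)) *
     of_bool (p = ?f a \<and> q = ?f b))"
    by (intro sum.cong refl) (simp add: code sign_measurement_mat_unit[OF \<epsilon>] del: of_bool_conj)
  also have "\<dots> = \<rho> $$ (?f a, ?f b) * of_bool (?g a \<and> ?g b) * (if ?f a = ?f b then 1 / 2 else \<epsilon> / 2)"
    by (rule sum_delta2(1)) simp_all
  also have "\<dots> = ?R $$ (a, b)"
    using ab \<rho> by (auto simp: repetition_code_def offdiag_scale_def)
  finally show "?L $$ (a, b) = ?R $$ (a, b)" .
qed (simp_all add: l r)

text \<open>Successive phase flips multiply their signs, so a single sign records all outcomes; the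
  scalar in between carries the weight of an outcome.\<close>

lemma offdiag_scale_compose:
  "offdiag_scale \<epsilon> (c \<cdot>\<^sub>m offdiag_scale \<epsilon>' \<rho>) = c \<cdot>\<^sub>m offdiag_scale (\<epsilon> * \<epsilon>') \<rho>"
  by (rule eq_matI) (auto simp: offdiag_scale_def)

section \<open>Assembling the LOCC decoder\<close>

lemma repetition_code_2:
  assumes "\<rho> \<in> carrier_mat 2 2"
  shows "repetition_code 2 \<rho> = \<rho>"
proof (rule eq_matI)
  fix a b assume "a < dim_row \<rho>" "b < dim_col \<rho>"
  then have "a \<in> {0, 1}" "b \<in> {0, 1}" using assms by auto
  then show "repetition_code 2 \<rho> $$ (a, b) = \<rho> $$ (a, b)"
    by (auto simp: repetition_code_def)
qed (use assms in simp_all)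

lemma prod_list_nth_split:
  assumes "i < length ds"
  shows "prod_list ds = prod_list (take i ds) * ds ! i * prod_list (drop (Suc i) ds)"
  by (subst id_take_nth_drop[OF assms]) (simp add: mult.assoc)

lemma prod_list_replicate_update:
  assumes "x < n"
  shows "prod_list (take x ((replicate n 1)[x := d])) = (1::nat)"
    and "prod_list (drop (Suc x) ((replicate n 1)[x := d])) = (1::nat)"
    and "prod_list ((replicate n 1)[x := d]) = (d::nat)"
proof -
  show *: "prod_list (take x ((replicate n 1)[x := d])) = (1::nat)"
    "prod_list (drop (Suc x) ((replicate n 1)[x := d])) = (1::nat)"
    by (simp_all add: take_update_cancel drop_update_cancel)
  show "prod_list ((replicate n 1)[x := d]) = d"
    using assms prod_list_nth_split[of x "(replicate n 1)[x := d]"] * by simp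
qed

text \<open>All other parties have dimension 1, so acting locally at \<open>x\<close> is acting on
  the whole state.\<close>

lemma local_supop_phase_map:
  assumes \<epsilon>: "\<epsilon> \<in> {1, -1}" and x: "x < n" and \<rho>: "\<rho> \<in> carrier_mat 2 2"
  shows "local_supop ((replicate n 1)[x := 2]) x 2 (phase_map \<epsilon>) \<rho> = offdiag_scale \<epsilon> \<rho>"
proof (rule eq_matI)
  fix a b assume "a < dim_row (offdiag_scale \<epsilon> \<rho>)" "b < dim_col (offdiag_scale \<epsilon> \<rho>)"
  then have ab: "a < 2" "b < 2" by simp_all
  have "local_supop ((replicate n 1)[x := 2]) x 2 (phase_map \<epsilon>) \<rho> $$ (a, b) =
     (\<Sum>p<2. \<Sum>q<2. \<rho> $$ (p, q) * phase_map \<epsilon> (mat_unit 2 p q) $$ (a, b))"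
    using ab x
    by (subst local_supop_index[OF _ _ prod_list_replicate_update(1,2)[OF x], of 2])
      (simp_all add: phase_map_def)
  also have "\<dots> = offdiag_scale \<epsilon> \<rho> $$ (a, b)"
  proof -
    have "a \<in> {0, 1}" "b \<in> {0, 1}" using ab by auto
    then show ?thesis
      by (auto simp: sum_lessThan_2 phase_map_eq[OF \<epsilon>] offdiag_scale_def mat_unit_index)
  qed
  finally show "local_supop ((replicate n 1)[x := 2]) x 2 (phase_map \<epsilon>) \<rho> $$ (a, b) =
    offdiag_scale \<epsilon> \<rho> $$ (a, b)" .
qed (use x prod_list_replicate_update(1,2)[OF x, of 2] in simp_all)

lemma msum_index: "a < d \<Longrightarrow> b < d \<Longrightarrow> msum d I M $$ (a, b) = (\<Sum>j\<in>I. M j $$ (a, b))"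
  by (simp add: msum_def)

lemma msum_dim [simp]: "dim_row (msum d I M) = d" "dim_col (msum d I M) = d"
  by (simp_all add: msum_def)

lemma msum_single:
  assumes "M j \<in> carrier_mat d d"
  shows "msum d {j} M = M j"
  using assms by (intro eq_matI) (simp_all add: msum_index)

text \<open>
  The sign \<open>t\<close> accumulates the outcomes broadcast so far; party \<open>x\<close> acts last, once all other
  systems have dimension 1.
\<close>

lemma locc_repetition_decoder:
  fixes \<sigma> :: "'s \<Rightarrow> complex"
  assumes \<sigma>: "\<And>s. \<sigma> s \<in> {1, -1}" and x: "x < n"
    and "length ds = n" "\<forall>i<n. ds ! i \<in> {1, 2}" "ds ! x = 2" "t \<in> {1, -1}"
  shows "\<exists>\<Lambda>. locc x ds ((replicate n 1)[x := 2]) \<Lambda> \<and>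
    (\<forall>s. \<forall>\<rho> \<in> carrier_mat 2 2. \<Lambda> s (repetition_code (prod_list ds) \<rho>) = offdiag_scale (t * \<sigma> s) \<rho>)"
  using assms(3-)
\<comment> \<open>Induction on the number of qubits still held by parties other than
  \<open>x\<close>.\<close>
proof (induction "card {i. i < n \<and> i \<noteq> x \<and> ds ! i = 2}" arbitrary: ds t)
  case 0
  let ?es = "(replicate n 1)[x := 2::nat]"
  have "{i. i < n \<and> i \<noteq> x \<and> ds ! i = 2} = {}" using 0(1) by simp
  then have ds: "ds = ?es"
    using 0(2-4) x by (intro nth_equalityI) (auto simp: nth_list_update)
  have sign: "t * \<sigma> s \<in> {1, -1}" for s using \<sigma>[of s] 0(5) by auto
  let ?\<Lambda> = "\<lambda>s R. msum (prod_list ?es) {..<1::nat} (\<lambda>k. id (local_supop ds x 2 (phase_map (t * \<sigma> s)) R))"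
  have "locc x ds ?es ?\<Lambda>"
  \<comment> \<open>A single round with one outcome, performed by \<open>x\<close>: the only
    instrument that depends on the classical value s.\<close>
  proof (rule locc_round[where \<Lambda> = "\<lambda>_ _. id" and m = 1 and e = "\<lambda>_. 2" and J = "\<lambda>s _. phase_map (t * \<sigma> s)"])
    show "x < length ds" using 0 x by simp
    show "\<forall>s. instrument (ds ! x) 1 (\<lambda>_. 2) (\<lambda>_. phase_map (t * \<sigma> s))"
      using instrument_phase_map[OF sign] 0(4) by simp
    have "ds[x := 2] = ?es" unfolding ds by simp
    then show "\<forall>k<1. locc x (ds[x := 2]) ?es (\<lambda>_. id)"
      by (simp add: locc_done)
  qed simp
  moreover have "?\<Lambda> s (repetition_code (prod_list ds) \<rho>) = offdiag_scale (t * \<sigma> s) \<rho>"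
    if "\<rho> \<in> carrier_mat 2 2" for s \<rho>
    unfolding ds prod_list_replicate_update(3)[OF x] repetition_code_2[OF that]
      local_supop_phase_map[OF sign x that]
    by (simp add: lessThan_Suc msum_single)
  ultimately show ?case by blast
next
  case (Suc m)
  let ?es = "(replicate n 1)[x := 2::nat]"
  from Suc(2) have "{i. i < n \<and> i \<noteq> x \<and> ds ! i = 2} \<noteq> {}"
    by (metis card.empty nat.distinct(1))
  then obtain i where i: "i < n" "i \<noteq> x" "ds ! i = 2" by blast
  let ?ds = "ds[i := 1]"
  define l r where "l = prod_list (take i ds)" and "r = prod_list (drop (Suc i) ds)"
  have "{j. j < n \<and> j \<noteq> x \<and> ?ds ! j = 2} = {j. j < n \<and> j \<noteq> x \<and> ds ! j = 2} - {i}"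
    using Suc(3) i by (auto simp: nth_list_update split: if_splits)
  then have card: "m = card {j. j < n \<and> j \<noteq> x \<and> ?ds ! j = 2}"
    using Suc(2) i by (simp add: card_Diff_singleton)
  have ds': "length ?ds = n" "\<forall>j<n. ?ds ! j \<in> {1, 2}" "?ds ! x = 2"
    using Suc(3-5) i by (auto simp: nth_list_update)
  have prod: "prod_list ds = l * 2 * r" "prod_list ?ds = l * r"
    using i Suc(3) prod_list_nth_split[of i ds] prod_list_nth_split[of i ?ds]
    by (simp_all add: l_def r_def)
  \<comment> \<open>The qubit of \<open>x\<close> remains, so 2 divides the total dimension, and no
    local dimension is zero.\<close>
  have lr: "2 \<le> l * r"
  proof -
    have "2 dvd l * r"
      using ds'(1,3) x unfolding prod(2)[symmetric] by (metis nth_mem prod_list_dvd)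
    moreover have "l * r \<noteq> 0"
      using ds'(1,2) unfolding prod(2)[symmetric] prod_list_zero_iff by (auto simp: in_set_conv_nth)
    ultimately show ?thesis by (intro dvd_imp_le) auto
  qed
  \<comment> \<open>Outcome k contributes this sign; the rest of the protocol is the induction
    hypothesis with t replaced by \<open>?\<epsilon> k * t\<close>.\<close>
  let ?\<epsilon> = "\<lambda>k::nat. if k = 0 then 1 else -1 :: complex"
  have "\<forall>k. \<exists>\<Lambda>. locc x ?ds ?es \<Lambda> \<and>
    (\<forall>s. \<forall>\<rho> \<in> carrier_mat 2 2. \<Lambda> s (repetition_code (l * r) \<rho>) = offdiag_scale (?\<epsilon> k * t * \<sigma> s) \<rho>)"
  proof
    fix k
    have "?\<epsilon> k * t \<in> {1, -1}" using Suc(6) by auto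
    from Suc(1)[OF card ds' this] show "\<exists>\<Lambda>. locc x ?ds ?es \<Lambda> \<and>
      (\<forall>s. \<forall>\<rho> \<in> carrier_mat 2 2. \<Lambda> s (repetition_code (l * r) \<rho>) = offdiag_scale (?\<epsilon> k * t * \<sigma> s) \<rho>)"
      unfolding prod(2) .
  qed
  then obtain \<Lambda> where \<Lambda>: "\<And>k. locc x ?ds ?es (\<Lambda> k)"
    "\<And>k s \<rho>. \<rho> \<in> carrier_mat 2 2 \<Longrightarrow> \<Lambda> k s (repetition_code (l * r) \<rho>) = offdiag_scale (?\<epsilon> k * t * \<sigma> s) \<rho>"
    by metis
  let ?\<Lambda> = "\<lambda>s R. msum (prod_list ?es) {..<2} (\<lambda>k. \<Lambda> k s (local_supop ds i 1 (sign_measurement (?\<epsilon> k)) R))"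
  have "locc x ds ?es ?\<Lambda>"
    \<comment> \<open>Since \<open>i \<noteq> x\<close>, the instrument must ignore s; the sign
      measurement does.\<close>
    by (rule locc_round[where e = "\<lambda>_. 1" and J = "\<lambda>_ k. sign_measurement (?\<epsilon> k)" and m = 2])
      (use i Suc(3) \<Lambda>(1) instrument_sign_measurement in simp_all)
  moreover have "?\<Lambda> s (repetition_code (prod_list ds) \<rho>) = offdiag_scale (t * \<sigma> s) \<rho>"
    if \<rho>: "\<rho> \<in> carrier_mat 2 2" for s \<rho>
  proof -
    have "\<Lambda> k s (local_supop ds i 1 (sign_measurement (?\<epsilon> k)) (repetition_code (prod_list ds) \<rho>)) =
      (1 / 2) \<cdot>\<^sub>m offdiag_scale (t * \<sigma> s) \<rho>" for k
    proof -
      have eps: "?\<epsilon> k \<in> {1, -1}" by simp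
      have "local_supop ds i 1 (sign_measurement (?\<epsilon> k)) (repetition_code (prod_list ds) \<rho>) =
        repetition_code (l * r) ((1 / 2) \<cdot>\<^sub>m offdiag_scale (?\<epsilon> k) \<rho>)"
        unfolding prod(1)
        by (rule local_supop_sign_measurement[OF eps \<rho> i(3) l_def[symmetric] r_def[symmetric] lr])
      \<comment> \<open>The sign produced by the measurement meets the same sign in the later
        correction, and their product is 1.\<close>
      moreover have "?\<epsilon> k * t * \<sigma> s * ?\<epsilon> k = t * \<sigma> s" by simp
      ultimately show ?thesis
        by (simp only: \<Lambda>(2) offdiag_scale_carrier smult_carrier_mat offdiag_scale_compose)
    qed
    \<comment> \<open>Both outcomes yield the same state with weight 1/2, so their sum has full
      weight.\<close>
    then show ?thesis
      unfolding prod_list_replicate_update(3)[OF x]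
      by (intro eq_matI) (simp_all add: msum_index)
  qed
  ultimately show ?case by blast
qed

section \<open>Perfect transmission\<close>

lemma quantum_channel_repetition_code:
  assumes N: "2 \<le> N"
  shows "quantum_channel 2 N (repetition_code N)"
proof -
  \<comment> \<open>The encoding isometry: the column of |p> has its 1 in row
    \<open>p * (N - 1)\<close>, the first or the last basis vector.\<close>
  let ?V = "mat N 2 (\<lambda>(a, p). of_bool (a = p * (N - 1))) :: complex mat"
  have "repetition_code N A = kraus_map N [?V] A" if A: "A \<in> carrier_mat 2 2" for A
  proof (rule eq_matI)
    fix a b assume "a < dim_row (kraus_map N [?V] A)" "b < dim_col (kraus_map N [?V] A)"
    then have ab: "a < N" "b < N" by simp_all
    show "repetition_code N A $$ (a, b) = kraus_map N [?V] A $$ (a, b)"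
      using ab N A by (subst kraus_map_index[of _ _ 2]) (auto simp: repetition_code_def sum_lessThan_2)
  qed simp_all
  then have "cp_map 2 N (repetition_code N)"
    by (subst cp_map_cong[of _ _ "kraus_map N [?V]"]) (auto intro: cp_map_kraus_map)
  moreover have "tr (repetition_code N A) = tr A" if A: "A \<in> carrier_mat 2 2" for A
  proof -
    \<comment> \<open>Only the two diagonal corners can be nonzero, and they are distinct because
      \<open>N\<close> is at least 2.\<close>
    have "(\<Sum>a<N. repetition_code N A $$ (a, a)) = (\<Sum>a\<in>{0, N - 1}. repetition_code N A $$ (a, a))"
      by (rule sum.mono_neutral_right) (use N in \<open>auto simp: repetition_code_def\<close>)
    also have "\<dots> = A $$ (0, 0) + A $$ (1, 1)"
      using N by (auto simp: repetition_code_def)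
    finally show ?thesis using A by (simp add: tr_def sum_lessThan_2)
  qed
  ultimately show ?thesis by (simp add: quantum_channel_def)
qed

section \<open>Measure-and-prepare form of \<open>N_XY\<close>\<close>

lemma mat_unit_diag_psd:
  "psd d (mat_unit d i i)"
  unfolding mat_unit_def by (rule psd_ketbra) simp

lemma entanglement_breaking_N_XY: "entanglement_breaking 2 2 N_XY"
proof -
  have cp: "cp_map 2 2 N_XY"
  proof -
    let ?Ks = "map (\<lambda>p. mat_unit 2 (2 - 1 - p) p) [0..<2]"
    have "N_XY A = kraus_map 2 ?Ks A" if "A \<in> carrier_mat 2 2" for A
      using kraus_rep_flip_diag[of 2] that by (simp add: kraus_rep_def N_XY_eq_flip_diag)
    then show ?thesis
      by (subst cp_map_cong[of _ _ "kraus_map 2 ?Ks"]) (auto intro!: cp_map_kraus_map)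
  qed
  have "tr (N_XY A) = tr A" if "A \<in> carrier_mat 2 2" for A
    using that by (simp add: N_XY_eq_flip_diag tr_def sum_lessThan_2 flip_diag_def)
  with cp have channel: "quantum_channel 2 2 N_XY" by (simp add: quantum_channel_def)
  \<comment> \<open>Measure in the computational basis and prepare the opposite basis state.\<close>
  let ?M = "\<lambda>j. mat_unit 2 j j" and ?\<sigma> = "\<lambda>j. mat_unit 2 (1 - j) (1 - j)"
  have "msum 2 {..<2} ?M = 1\<^sub>m 2"
    by (rule eq_matI) (auto simp: msum_index sum_lessThan_2 mat_unit_index)
  then have "povm 2 {..<2} ?M"
    by (simp add: povm_def mat_unit_diag_psd)
  moreover have "density 2 (?\<sigma> j)" if "j < 2" for j
    using that by (auto simp: density_def mat_unit_diag_psd tr_def carrier_matD[OF mat_unit_carrier]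
      sum_lessThan_2 mat_unit_index)
  moreover have "N_XY \<rho> = msum 2 {..<2} (\<lambda>j. tr (?M j * \<rho>) \<cdot>\<^sub>m ?\<sigma> j)"
    if \<rho>: "\<rho> \<in> carrier_mat 2 2" for \<rho>
  proof (rule eq_matI)
    fix a b assume "a < dim_row (msum 2 {..<2} (\<lambda>j. tr (?M j * \<rho>) \<cdot>\<^sub>m ?\<sigma> j))"
      "b < dim_col (msum 2 {..<2} (\<lambda>j. tr (?M j * \<rho>) \<cdot>\<^sub>m ?\<sigma> j))"
    then have ab: "a < 2" "b < 2" by simp_all
    have "tr (?M j * \<rho>) = \<rho> $$ (j, j)" if "j < 2" for j
    proof -
      have "j \<in> {0, 1}" using that by auto
      then show ?thesis using \<rho>
        by (auto simp: tr_def carrier_matD[OF mat_unit_carrier] sum_lessThan_2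
          mat_mult_index[OF mat_unit_carrier \<rho>] mat_unit_index simp del: index_mult_mat(1))
    qed
    then have tr: "tr (?M 0 * \<rho>) = \<rho> $$ (0, 0)" "tr (?M 1 * \<rho>) = \<rho> $$ (1, 1)" by simp_all
    have "a \<in> {0, 1}" "b \<in> {0, 1}" using ab by auto
    then show "N_XY \<rho> $$ (a, b) = msum 2 {..<2} (\<lambda>j. tr (?M j * \<rho>) \<cdot>\<^sub>m ?\<sigma> j) $$ (a, b)"
      unfolding N_XY_eq_flip_diag[OF \<rho>] msum_index[OF ab] sum_lessThan_2 tr
      by (auto simp: flip_diag_def mat_unit_index carrier_matD[OF mat_unit_carrier])
  qed (use \<rho> in \<open>simp_all add: N_XY_eq_flip_diag\<close>)
  ultimately show ?thesis
    unfolding entanglement_breaking_def using channel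
    by (intro conjI exI[of _ "2 :: nat"] exI[of _ ?M] exI[of _ ?\<sigma>]) simp_all
qed

section \<open>Measuring the order qubit after the switch\<close>

lemma ket_plus_eq: "ket_plus = sign_vec 1"
  by (rule eq_vecI) (auto simp: ket_plus_def sign_vec_def ket0_def ket1_def unit_vec_def less_2_cases_iff)

lemma ketbra_sign_vec_index:
  assumes "\<epsilon> \<in> {1, -1}" "c < 2" "c' < 2"
  shows "ketbra (sign_vec \<epsilon>) (sign_vec \<epsilon>) $$ (c, c') = (if c = c' then 1 / 2 else \<epsilon> / 2)"
  using assms sign_vec_product[OF assms] by (simp add: ketbra_def)

text \<open>The identity factor preserves the leading digit, so \<open>P\<close> is contracted with
  the order digits of each block only.\<close>

lemma ptrace2_local_mult_index:
  assumes P: "P \<in> carrier_mat k k" and S: "S \<in> carrier_mat (d * k) (d * k)" and ij: "i < d" "j < d"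
  shows "ptrace2 d k ((1\<^sub>m d \<otimes>\<^sub>m P) * S) $$ (i, j) = (\<Sum>c<k. \<Sum>c'<k. P $$ (c, c') * S $$ (i * k + c', j * k + c))"
proof -
  have "((1\<^sub>m d \<otimes>\<^sub>m P) * S) $$ (i * k + c, j * k + c) = (\<Sum>c'<k. P $$ (c, c') * S $$ (i * k + c', j * k + c))"
    if c: "c < k" for c
  proof -
    have "((1\<^sub>m d \<otimes>\<^sub>m P) * S) $$ (i * k + c, j * k + c) =
      (\<Sum>x<d * k. (1\<^sub>m d \<otimes>\<^sub>m P) $$ (i * k + c, x) * S $$ (x, j * k + c))"
      by (rule mat_mult_index[OF tensor_mat_carrier[OF one_carrier_mat P] S])
        (use index_lt_mult[OF ij(1) c] index_lt_mult[OF ij(2) c] in simp_all)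
    also have "\<dots> = (\<Sum>i'<d. \<Sum>c'<k. (1\<^sub>m d \<otimes>\<^sub>m P) $$ (i * k + c, i' * k + c') * S $$ (i' * k + c', j * k + c))"
      by (rule sum_mult_split)
    also have "\<dots> = (\<Sum>i'<d. if i' = i then \<Sum>c'<k. P $$ (c, c') * S $$ (i' * k + c', j * k + c) else 0)"
    proof (rule sum.cong[OF refl])
      fix i' assume "i' \<in> {..<d}"
      then have i': "i' < d" by simp
      have "(1\<^sub>m d \<otimes>\<^sub>m P) $$ (i * k + c, i' * k + c') = of_bool (i' = i) * P $$ (c, c')" if "c' < k" for c'
        using tensor_mat_index[OF one_carrier_mat P index_lt_mult[OF ij(1) c] index_lt_mult[OF i' that]] c that ij i'
        by simp
      then show "(\<Sum>c'<k. (1\<^sub>m d \<otimes>\<^sub>m P) $$ (i * k + c, i' * k + c') * S $$ (i' * k + c', j * k + c)) =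
        (if i' = i then \<Sum>c'<k. P $$ (c, c') * S $$ (i' * k + c', j * k + c) else 0)"
        by simp
    qed
    finally show ?thesis using ij by simp
  qed
  then show ?thesis using ij by (simp add: ptrace2_def)
qed

text \<open>The code occupies the four corners: the diagonal ones come from the blocks diagonal in
  the order qubit, the other two from the off-diagonal blocks, which the measurement weights by
  \<open>\<epsilon>\<close>.\<close>

lemma switched_repetition_code:
  assumes \<epsilon>: "\<epsilon> \<in> {1, -1}" and N: "2 \<le> N"
    and \<Phi>: "\<And>X. X \<in> carrier_mat N N \<Longrightarrow> \<Phi> X = flip_diag N X"
  shows "ptrace2 N 2 ((1\<^sub>m N \<otimes>\<^sub>m ketbra (sign_vec \<epsilon>) (sign_vec \<epsilon>)) *
      switched_channel N (ketbra ket_plus ket_plus) \<Phi> \<Phi> (repetition_code N \<rho>)) =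
    repetition_code N ((1 / 2) \<cdot>\<^sub>m offdiag_scale \<epsilon> \<rho>)" (is "?L = ?R")
proof (rule eq_matI)
  fix i j assume "i < dim_row ?R" "j < dim_col ?R"
  then have ij: "i < N" "j < N" by simp_all
  let ?S = "switched_channel N (ketbra ket_plus ket_plus) \<Phi> \<Phi> (repetition_code N \<rho>)"
  let ?P = "ketbra (sign_vec \<epsilon>) (sign_vec \<epsilon>)"
  have P: "?P \<in> carrier_mat 2 2" and \<omega>: "ketbra ket_plus ket_plus \<in> carrier_mat 2 2"
    by (intro carrier_matI; simp add: ketbra_def ket_plus_eq)+
  have S: "?S \<in> carrier_mat (N * 2) (N * 2)"
    by (simp add: switched_channel_def quantum_switch_def)
  have S_index: "?S $$ (i * 2 + c', j * 2 + c) = (1 / 2) *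
    (if j = (if c' = c then i else N - 1 - i) then repetition_code N \<rho> $$ (i, j) else 0)"
    if "c < 2" "c' < 2" for c c'
    using that ij
    by (subst switched_channel_flip_diag[OF \<Phi> \<Phi> repetition_code_carrier \<omega>])
      (simp_all add: ket_plus_eq ketbra_sign_vec_index)
  have "?L $$ (i, j) = (\<Sum>c<2. \<Sum>c'<2. ?P $$ (c, c') * ?S $$ (i * 2 + c', j * 2 + c))"
    by (rule ptrace2_local_mult_index[OF P S ij])
  \<comment> \<open>Every entry of the order state is 1/2. The two terms with equal order digits
    give 1/4 each, the two with different digits \<open>\<epsilon> / 4\<close> each.\<close>
  also have "\<dots> = (1 / 2) * (if j = i then repetition_code N \<rho> $$ (i, j) else 0) +
      (\<epsilon> / 2) * (if j = N - 1 - i then repetition_code N \<rho> $$ (i, j) else 0)"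
    by (simp add: sum_lessThan_2 S_index ketbra_sign_vec_index[OF \<epsilon>])
  \<comment> \<open>At the corners the diagonal and the antidiagonal do not meet since
    \<open>N\<close> is at least 2; elsewhere the code vanishes, even where they cross.\<close>
  also have "\<dots> = ?R $$ (i, j)"
    using ij N by (auto simp: repetition_code_def offdiag_scale_def)
  finally show "?L $$ (i, j) = ?R $$ (i, j)" .
qed (simp_all add: ptrace2_def)

definition outcome_sign :: "order_outcome \<Rightarrow> complex" where
  "outcome_sign s = (case s of Out_plus \<Rightarrow> 1 | Out_minus \<Rightarrow> -1)"

lemma outcome_sign_cases: "outcome_sign s \<in> {1, -1}"
  by (cases s) (simp_all add: outcome_sign_def)

lemma povm_ketbra_sign_vec:
  "povm 2 {Out_plus, Out_minus} (\<lambda>s. ketbra (sign_vec (outcome_sign s)) (sign_vec (outcome_sign s)))"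
proof -
  have "msum 2 {Out_plus, Out_minus} (\<lambda>s. ketbra (sign_vec (outcome_sign s)) (sign_vec (outcome_sign s))) = 1\<^sub>m 2"
    by (rule eq_matI) (simp_all add: msum_index ketbra_sign_vec_index outcome_sign_def)
  moreover have "psd 2 (ketbra (sign_vec \<epsilon>) (sign_vec \<epsilon>))" for \<epsilon>
    by (rule psd_ketbra) (simp add: carrier_vecI)
  ultimately show ?thesis by (simp add: povm_def)
qed

theorem mainTheorem3:
  shows "entanglement_breaking 2 2 N_XY \<and>
    (\<forall>n\<ge>2. \<exists>(\<E> :: supop) (P :: order_outcome \<Rightarrow> complex mat).
       quantum_channel 2 (2 ^ n) \<E> \<and>
       povm 2 {Out_plus, Out_minus} P \<and>
       (\<forall>x<n. \<exists>\<Lambda> :: order_outcome \<Rightarrow> supop.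
          locc x (replicate n 2) ((replicate n 1)[x := 2]) \<Lambda> \<and>
          (\<forall>\<rho>. density 2 \<rho> \<longrightarrow>
             msum 2 {Out_plus, Out_minus} (\<lambda>s.
               \<Lambda> s (ptrace2 (2 ^ n) 2
                 ((1\<^sub>m (2 ^ n) \<otimes>\<^sub>m P s) *
                  switched_channel (2 ^ n) (ketbra ket_plus ket_plus)
                    (supop_power 2 N_XY n) (supop_power 2 N_XY n) (\<E> \<rho>)))) = \<rho>)))"
proof (intro conjI allI impI entanglement_breaking_N_XY)
  fix n :: nat assume n: "2 \<le> n"
  define N :: nat where "N = 2 ^ n"
  have N: "2 \<le> N" unfolding N_def using n power_increasing[of 1 n "2::nat"] by simp
  let ?P = "\<lambda>s. ketbra (sign_vec (outcome_sign s)) (sign_vec (outcome_sign s))"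
  have decode: "\<exists>\<Lambda> :: order_outcome \<Rightarrow> supop.
      locc x (replicate n 2) ((replicate n 1)[x := 2]) \<Lambda> \<and>
      (\<forall>\<rho>. density 2 \<rho> \<longrightarrow>
         msum 2 {Out_plus, Out_minus} (\<lambda>s. \<Lambda> s (ptrace2 N 2 ((1\<^sub>m N \<otimes>\<^sub>m ?P s) *
           switched_channel N (ketbra ket_plus ket_plus)
             (supop_power 2 N_XY n) (supop_power 2 N_XY n) (repetition_code N \<rho>)))) = \<rho>)"
    if x: "x < n" for x
  proof -
    obtain \<Lambda> where \<Lambda>: "locc x (replicate n 2) ((replicate n 1)[x := 2]) \<Lambda>"
      "\<forall>s. \<forall>\<rho> \<in> carrier_mat 2 2. \<Lambda> s (repetition_code (prod_list (replicate n 2)) \<rho>) =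
        offdiag_scale (1 * outcome_sign s) \<rho>"
      \<comment> \<open>The known phase is the sign of the order outcome; the accumulated sign
        starts at 1.\<close>
      using locc_repetition_decoder[of outcome_sign x n "replicate n 2" 1, OF outcome_sign_cases x] x
      by auto
    have "msum 2 {Out_plus, Out_minus} (\<lambda>s. \<Lambda> s (ptrace2 N 2 ((1\<^sub>m N \<otimes>\<^sub>m ?P s) *
           switched_channel N (ketbra ket_plus ket_plus)
             (supop_power 2 N_XY n) (supop_power 2 N_XY n) (repetition_code N \<rho>)))) = \<rho>"
      if "density 2 \<rho>" for \<rho>
    proof -
      have \<rho>: "\<rho> \<in> carrier_mat 2 2" using that by (simp add: density_def psd_carrier)
      \<comment> \<open>For each order outcome the decoder repeats the sign of the switch and
        removes it, leaving the weight 1/2; the two outcomes then add up to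
        \<open>\<rho>\<close>.\<close>
      have "\<Lambda> s (ptrace2 N 2 ((1\<^sub>m N \<otimes>\<^sub>m ?P s) *
           switched_channel N (ketbra ket_plus ket_plus)
             (supop_power 2 N_XY n) (supop_power 2 N_XY n) (repetition_code N \<rho>))) = (1 / 2) \<cdot>\<^sub>m \<rho>" for s
      proof -
        have "ptrace2 N 2 ((1\<^sub>m N \<otimes>\<^sub>m ?P s) *
             switched_channel N (ketbra ket_plus ket_plus)
               (supop_power 2 N_XY n) (supop_power 2 N_XY n) (repetition_code N \<rho>)) =
            repetition_code N ((1 / 2) \<cdot>\<^sub>m offdiag_scale (outcome_sign s) \<rho>)"
          by (rule switched_repetition_code[OF outcome_sign_cases N]) (simp add: N_def supop_power_N_XY)
        moreover have "offdiag_scale (outcome_sign s) ((1 / 2) \<cdot>\<^sub>m offdiag_scale (outcome_sign s) \<rho>) = (1 / 2) \<cdot>\<^sub>m \<rho>"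
          unfolding offdiag_scale_compose using outcome_sign_cases[of s] \<rho>
          by (intro eq_matI) (auto simp: offdiag_scale_def)
        ultimately show ?thesis using \<Lambda>(2) by (simp add: N_def)
      qed
      then show ?thesis using \<rho> by (intro eq_matI) (simp_all add: msum_index)
    qed
    with \<Lambda>(1) show ?thesis by blast
  qed
  show "\<exists>(\<E> :: supop) (P :: order_outcome \<Rightarrow> complex mat).
       quantum_channel 2 (2 ^ n) \<E> \<and>
       povm 2 {Out_plus, Out_minus} P \<and>
       (\<forall>x<n. \<exists>\<Lambda> :: order_outcome \<Rightarrow> supop.
          locc x (replicate n 2) ((replicate n 1)[x := 2]) \<Lambda> \<and>
          (\<forall>\<rho>. density 2 \<rho> \<longrightarrow>
             msum 2 {Out_plus, Out_minus} (\<lambda>s.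
               \<Lambda> s (ptrace2 (2 ^ n) 2
                 ((1\<^sub>m (2 ^ n) \<otimes>\<^sub>m P s) *
                  switched_channel (2 ^ n) (ketbra ket_plus ket_plus)
                    (supop_power 2 N_XY n) (supop_power 2 N_XY n) (\<E> \<rho>)))) = \<rho>))"
    unfolding N_def[symmetric]
    using quantum_channel_repetition_code[OF N] povm_ketbra_sign_vec decode
    by (intro exI[of _ "repetition_code N"] exI[of _ ?P] conjI) simp_all
qed

end
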